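(* For every positive integer $k$, let $R(k):=\#\{A\in\mathbb{A}\cap(0,e^{-e}) : h_o(A)\text{ and }h_e(A)\text{ are algebraic and }\mathrm{ord}(A)=k\}$. Then $R(k)=1$ if there exists $v\in\mathbb{N}$ with $k=v^v$, and $R(k)=0$ otherwise.
   Context: $\mathbb{A}$ denotes the set of algebraic numbers. For $x\in(0,e^{-e})$, the sequences $x,\ x^{x^x},\ x^{x^{x^{x^x}}},\ldots$ (towers of odd height) and $x^x,\ x^{x^{x^x}},\ldots$ (towers of even height) converge; their limits are denoted $h_o(x)$ and $h_e(x)$ respectively, and they satisfy $h_o(x)=x^{h_e(x)}$, $h_e(x)=x^{h_o(x)}$, $0<h_o(x)<1/e<h_e(x)<1$. For an algebraic number $A$, $\mathrm{ord}(A):=\min\{n\in\mathbb{N}: A^n\in\mathbb{Q}\}$ if such $n$ exists, and $\infty$ otherwise. *)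

theory Defs
  imports "HOL-Analysis.Analysis" "HOL-Computational_Algebra.Polynomial" "HOL-Library.Extended_Nat"
begin

fun tower :: "real \<Rightarrow> nat \<Rightarrow> real" where
  "tower x 0 = x"
| "tower x (Suc n) = x powr (tower x n)"

text \<open>Limit of the towers of odd height (x, x^x^x, ...).\<close>
definition h_o :: "real \<Rightarrow> real" where
  "h_o x = lim (\<lambda>n. tower x (2 * n))"

text \<open>Limit of the towers of even height (x^x, x^x^x^x, ...).\<close>
definition h_e :: "real \<Rightarrow> real" where
  "h_e x = lim (\<lambda>n. tower x (2 * n + 1))"

definition alg_ord :: "real \<Rightarrow> enat" where
  "alg_ord A = (if \<exists>n::nat. n \<ge> 1 \<and> A ^ n \<in> \<rat>
                then enat (LEAST n::nat. n \<ge> 1 \<and> A ^ n \<in> \<rat>) else \<infinity>)"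

definition R_set :: "nat \<Rightarrow> real set" where
  "R_set k = {A. algebraic A \<and> 0 < A \<and> A < exp (- exp 1) \<and>
                 algebraic (h_o A) \<and> algebraic (h_e A) \<and> alg_ord A = enat k}"

end

theory Submission
  imports Defs "Jordan_Normal_Form.Char_Poly" "HOL-Real_Asymp.Real_Asymp"
begin

text \<open>
  Write \<open>a = h_o(A)\<close> and \<open>b = h_e(A)\<close>, so that \<open>a = A^b\<close>, \<open>b = A^a\<close> and \<open>a < b\<close>. If all three numbers
  are algebraic, the Gelfond--Schneider theorem forces \<open>a\<close> and \<open>b\<close> to be rational. The rational
  solutions of \<open>a^a = b^b\<close> are \<open>a = (v/(v+1))^(v+1)\<close>, \<open>b = (v/(v+1))^v\<close>; for them
  \<open>A = (v/(v+1))^((v+1)^(v+1)/v^v)\<close>, and since \<open>v/(v+1)\<close> is not a proper power of a rational number,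
  \<open>A\<close> has order \<open>v^v\<close>. Conversely \<open>(a, b)\<close> is recovered from \<open>A\<close> as the only 2-cycle of
  \<open>t \<mapsto> A^t\<close>, because \<open>ln (- ln A)\<close> is a strictly increasing function of \<open>b/a\<close>.

  Only real numbers occur, so Gelfond--Schneider follows from an interpolation determinant with
  entries \<open>x_j^k \<alpha>^(l x_j)\<close> at the points \<open>x_j = s + t \<beta>\<close>. It is nonzero because a real exponential
  polynomial has few zeros (Rolle), small because replacing each column by an interpolation error
  does not change it, and not too small because, up to a denominator, it is a nonzero eigenvalue of
  an integer matrix with controlled entries.
\<close>

section \<open>Rolle's theorem, interpolation and exponential polynomials\<close>

text \<open>Points are added from left to right; each new largest point \<open>b\<close> yields a
  zero of \<open>f'\<close> strictly between the old maximum and \<open>b\<close>. The half-open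
  interval in the conclusion keeps this zero apart from those found before.\<close>

lemma rolle_finite:
  fixes f f' :: "real \<Rightarrow> real"
  assumes "finite Z" "Z \<noteq> {}"
    and der: "\<And>x. (f has_real_derivative f' x) (at x)"
    and "\<And>z. z \<in> Z \<Longrightarrow> f z = 0"
  shows "\<exists>Z'. finite Z' \<and> card Z = Suc (card Z') \<and> Z' \<subseteq> {Min Z..<Max Z} \<and> (\<forall>z\<in>Z'. f' z = 0)"
  using assms(1,2,4)
proof (induction Z rule: finite_linorder_max_induct)
  case empty
  then show ?case by simp
next
  case (insert b A)
  show ?case
  proof (cases "A = {}")
    case True
    then show ?thesis by (intro exI[of _ "{}"]) auto
  next
    case False
    define c where "c = Max A"
    have c: "c \<in> A" "c < b" using insert.hyps False by (auto simp: c_def)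
    obtain Z' where Z': "finite Z'" "card A = Suc (card Z')" "Z' \<subseteq> {Min A..<Max A}" "\<forall>z\<in>Z'. f' z = 0"
      using insert.IH False insert.prems(2) by auto
    have "\<exists>z>c. z < b \<and> f' z = 0"
    proof (rule Rolle_deriv[where f = f and f' = "\<lambda>x h. f' x * h", THEN exE])
      show "c < b" by fact
      show "f c = f b" using c insert.prems(2) by auto
      show "continuous_on {c..b} f"
        using der by (meson DERIV_isCont continuous_at_imp_continuous_on)
      show "(f has_derivative (\<lambda>h. f' x * h)) (at x)" for x
        using der[of x] by (simp add: has_field_derivative_def)
      fix z assume "c < z \<and> z < b \<and> (\<lambda>h. f' z * h) = (\<lambda>v. 0)"
      then show ?thesis by (metis mult.right_neutral)
    qed
    then obtain z where z: "c < z" "z < b" "f' z = 0" by auto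
    have minmax: "Min (insert b A) = Min A" "Max (insert b A) = b"
      using insert.hyps False c
      by (auto intro!: Max_eqI simp: less_imp_le)
    have "Min A \<le> c" using c insert.hyps by simp
    then have "insert z Z' \<subseteq> {Min A..<b}" using Z' z c by (force simp: c_def)
    moreover have "z \<notin> Z'" using Z' z by (force simp: c_def)
    moreover have "b \<notin> A" using insert.hyps by auto
    ultimately show ?thesis
      using Z' z insert.hyps by (intro exI[of _ "insert z Z'"]) (auto simp: minmax)
  qed
qed

text \<open>Each pass through \<open>rolle_finite\<close> costs one zero and stays in the hull of
  the previous ones, so one of n + 1 zeros survives n differentiations.\<close>

lemma rolle_iterated:
  fixes F :: "nat \<Rightarrow> real \<Rightarrow> real"
  assumes "finite Z" "card Z = Suc n" "Z \<subseteq> {a..b}"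
    and "\<And>n x. (F n has_real_derivative F (Suc n) x) (at x)"
    and "\<And>z. z \<in> Z \<Longrightarrow> F 0 z = 0"
  shows "\<exists>\<xi>\<in>{a..b}. F n \<xi> = 0"
  using assms
proof (induction n arbitrary: F Z)
  case 0
  then obtain z where "Z = {z}" by (auto simp: card_Suc_eq)
  then show ?case using 0 by auto
next
  case (Suc n)
  have ne: "Z \<noteq> {}" using Suc.prems(2) by auto
  obtain Z' where Z': "finite Z'" "card Z = Suc (card Z')" "Z' \<subseteq> {Min Z..<Max Z}" "\<forall>z\<in>Z'. F 1 z = 0"
    using rolle_finite[OF Suc.prems(1) ne, of "F 0" "F 1"] Suc.prems by auto
  have "Min Z \<in> Z" "Max Z \<in> Z" using Suc.prems(1) ne by auto
  then have "Z' \<subseteq> {a..b}" using Z'(3) Suc.prems(3) by force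
  then show ?case
    using Suc.IH[of Z' "\<lambda>n. F (Suc n)"] Z' Suc.prems by auto
qed

text \<open>The coefficients are the Lagrange basis polynomials of the nodes \<open>x k\<close>, k <
  j, evaluated at \<open>x j\<close>. They depend on the nodes only, so one choice of
  \<open>c\<close> serves all functions, that is, all rows of the determinant at once. The
  right-hand side is the classical remainder term.\<close>

lemma interpolation_error:
  fixes x :: "nat \<Rightarrow> real"
  assumes inj: "inj_on x {..j}" and ran: "x ` {..j} \<subseteq> {a..b}"
  shows "\<exists>c. \<forall>F. (\<forall>n t. (F n has_real_derivative F (Suc n) t) (at t)) \<longrightarrow>
           (\<exists>\<xi>\<in>{a..b}. F 0 (x j) - (\<Sum>k<j. c k * F 0 (x k)) = (\<Prod>k<j. x j - x k) * F j \<xi> / fact j)"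
proof -
  define l where "l k = (\<Prod>m\<in>{..<j}-{k}. Polynomial.smult (1 / (x k - x m)) [:- x m, 1:])" for k
  define W where "W = (\<Prod>k<j. [:- x k, 1:])"
  have ne: "x i \<noteq> x k" if "i \<le> j" "k \<le> j" "i \<noteq> k" for i k
    using inj that by (auto simp: inj_on_def)
  have degl: "degree (l k) < j" if "k < j" for k
  proof -
    have "degree (l k) \<le> (\<Sum>m\<in>{..<j}-{k}. degree (Polynomial.smult (1 / (x k - x m)) [:- x m, 1:]))"
      unfolding l_def by (intro order.trans[OF degree_prod_sum_le]) auto
    also have "\<dots> \<le> (\<Sum>m\<in>{..<j}-{k}. 1)" by (intro sum_mono) auto
    also have "\<dots> < j" using that by simp
    finally show ?thesis .
  qed
  have polyl: "poly (l k) (x i) = (if i = k then 1 else 0)" if "k < j" "i < j" for i k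
  proof (cases "i = k")
    case True
    then show ?thesis using that ne
      by (auto simp: l_def poly_prod diff_divide_distrib[symmetric] intro!: prod.neutral)
  next
    case False
    then show ?thesis using that by (auto simp: l_def poly_prod)
  qed
  have degW: "degree W = j" unfolding W_def by (subst degree_prod_eq_sum_degree) auto
  have monW: "coeff W j = 1"
  proof -
    have "lead_coeff W = 1" unfolding W_def by (simp add: lead_coeff_prod)
    then show ?thesis by (simp add: degW)
  qed
  have Wj: "poly W (x j) = (\<Prod>k<j. x j - x k)" by (simp add: W_def poly_prod)
  have Wk: "poly W (x k) = 0" if "k < j" for k using that by (auto simp: W_def poly_prod)
  have Wne: "poly W (x j) \<noteq> 0" using ne by (auto simp: Wj)
  show ?thesis
  proof (intro exI[of _ "\<lambda>k. poly (l k) (x j)"] allI impI)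
    fix F :: "nat \<Rightarrow> real \<Rightarrow> real"
    assume F: "\<forall>n t. (F n has_real_derivative F (Suc n) t) (at t)"
    \<comment> \<open>\<open>P\<close> interpolates \<open>F 0\<close> at the first j nodes. As
      \<open>W\<close> vanishes there, adding \<open>K\<close> times \<open>W\<close> corrects the
      value at \<open>x j\<close> as well, so \<open>G 0\<close> has j + 1 zeros.\<close>
    define P where "P = (\<Sum>k<j. Polynomial.smult (F 0 (x k)) (l k))"
    define K where "K = (F 0 (x j) - poly P (x j)) / poly W (x j)"
    define Q where "Q = P + Polynomial.smult K W"
    define G where "G n t = F n t - poly ((pderiv ^^ n) Q) t" for n t
    have degP: "coeff P n = 0" if "n \<ge> j" for n
      using that degl by (auto simp: P_def coeff_sum intro!: sum.neutral coeff_eq_0)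
        (meson order.strict_trans2 coeff_eq_0)
    have "degree Q \<le> j" unfolding Q_def
      by (rule degree_le) (use degP degW in \<open>auto simp: coeff_eq_0\<close>)
    moreover have "coeff Q j = K" using degP[of j] monW by (simp add: Q_def)
    \<comment> \<open>Only a constant is left of \<open>Q\<close> after j differentiations, so a
      zero \<xi> of \<open>G j\<close> gives \<open>K = F j \<xi> / fact j\<close>.\<close>
    ultimately have Qj: "(pderiv ^^ j) Q = [:fact j * K:]"
      by (intro poly_eqI)
        (simp add: coeff_higher_pderiv coeff_pCons pochhammer_fact coeff_eq_0 split: nat.split)
    have "\<exists>\<xi>\<in>{a..b}. G j \<xi> = 0"
    proof (rule rolle_iterated[of "x ` {..j}"])
      show "card (x ` {..j}) = Suc j" using inj by (simp add: card_image)
      show "(G n has_real_derivative G (Suc n) t) (at t)" for n t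
        unfolding G_def using F by (auto intro!: derivative_eq_intros poly_DERIV)
      fix z assume "z \<in> x ` {..j}"
      then obtain k where k: "k \<le> j" "z = x k" by auto
      show "G 0 z = 0"
      proof (cases "k = j")
        case True
        then show ?thesis using Wne k by (simp add: G_def Q_def K_def)
      next
        case False
        then have "poly P (x k) = (\<Sum>i<j. F 0 (x i) * (if k = i then 1 else 0))"
          using k polyl by (auto simp: P_def poly_sum intro!: sum.cong)
        then show ?thesis using False k
            by (simp add: G_def Q_def Wk if_distrib[of "\<lambda>x. _ * x"] sum.delta cong: if_cong)
      qed
    qed (use ran in auto)
    then obtain \<xi> where \<xi>: "\<xi> \<in> {a..b}" "F j \<xi> = fact j * K" by (auto simp: G_def Qj)
    have "(\<Sum>k<j. poly (l k) (x j) * F 0 (x k)) = poly P (x j)"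
      by (simp add: P_def poly_sum mult.commute)
    then show "\<exists>\<xi>\<in>{a..b}. F 0 (x j) - (\<Sum>k<j. poly (l k) (x j) * F 0 (x k)) =
        (\<Prod>k<j. x j - x k) * F j \<xi> / fact j"
      using \<xi> Wne by (intro bexI[of _ \<xi>]) (simp_all add: K_def Wj)
  qed
qed

section \<open>Derivative bounds and zeros of exponential polynomials\<close>

lemma power_over_fact_le_exp:
  fixes x :: real
  assumes "x \<ge> 0"
  shows "x ^ n / fact n \<le> exp x"
proof -
  have "(\<Sum>k\<in>{n}. x ^ k /\<^sub>R fact k) \<le> (\<Sum>k. x ^ k /\<^sub>R fact k)"
    using assms by (intro sum_le_suminf summable_exp_generic) auto
  then have "x ^ n /\<^sub>R fact n \<le> exp x" unfolding exp_def by simp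
  moreover have "x ^ n /\<^sub>R fact n = x ^ n / fact n" unfolding real_scaleR_def divide_inverse by (rule mult.commute)
  ultimately show ?thesis by simp
qed

text \<open>Cauchy's estimate with radius \<rho>, obtained on the real line by induction on i. For i
  = 0 it is (|w| \<rho>)^n / n! \<le> exp (|w| \<rho>). Multiplication by x turns \<open>F n\<close>
  into x \<open>F n\<close> + n \<open>F (n - 1)\<close> by the Leibniz rule, and the two terms
  contribute the factors X and \<rho>.\<close>

lemma monomial_exp_derivatives:
  fixes w X \<rho> :: real
  assumes "X \<ge> 0" "\<rho> > 0"
  shows "\<exists>F. F 0 = (\<lambda>x. x ^ i * exp (w * x)) \<and>
           (\<forall>n t. (F n has_real_derivative F (Suc n) t) (at t)) \<and>
           (\<forall>n t. \<bar>t\<bar> \<le> X \<longrightarrow> \<bar>F n t\<bar> \<le> fact n * ((X + \<rho>) ^ i * exp (\<bar>w\<bar> * (X + \<rho>))) / \<rho> ^ n)"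
proof (induction i)
  case 0
  show ?case
  proof (intro exI[of _ "\<lambda>n x. w ^ n * exp (w * x)"] conjI allI impI)
    fix n :: nat and t :: real assume "\<bar>t\<bar> \<le> X"
    then have "\<bar>w * t\<bar> \<le> \<bar>w\<bar> * X" by (simp add: abs_mult mult_left_mono)
    then have e: "exp (w * t) \<le> exp (\<bar>w\<bar> * X)" by simp
    have "\<bar>w\<bar> ^ n \<le> fact n * exp (\<bar>w\<bar> * \<rho>) / \<rho> ^ n"
      using power_over_fact_le_exp[of "\<bar>w\<bar> * \<rho>" n] assms
      by (simp add: power_mult_distrib pos_divide_le_eq pos_le_divide_eq mult.commute)
    have "\<bar>w ^ n * exp (w * t)\<bar> = \<bar>w\<bar> ^ n * exp (w * t)" by (simp add: abs_mult power_abs)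
    also have "\<dots> \<le> (fact n * exp (\<bar>w\<bar> * \<rho>) / \<rho> ^ n) * exp (\<bar>w\<bar> * X)"
      using assms by (intro mult_mono \<open>\<bar>w\<bar> ^ n \<le> _\<close> e) auto
    also have "\<dots> = fact n * ((X + \<rho>) ^ 0 * exp (\<bar>w\<bar> * (X + \<rho>))) / \<rho> ^ n"
      by (simp add: exp_add distrib_left)
    finally show "\<bar>w ^ n * exp (w * t)\<bar> \<le> fact n * ((X + \<rho>) ^ 0 * exp (\<bar>w\<bar> * (X + \<rho>))) / \<rho> ^ n" .
  next
    fix n :: nat and t :: real
    have "((\<lambda>x. w ^ n * exp (w * x)) has_real_derivative w ^ n * (exp (w * t) * w)) (at t)"
      by (intro DERIV_cmult) (rule derivative_eq_intros refl | simp)+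
    then show "((\<lambda>x. w ^ n * exp (w * x)) has_real_derivative w ^ Suc n * exp (w * t)) (at t)"
      by (simp add: mult_ac)
  qed simp
next
  case (Suc i)
  then obtain F where F: "F 0 = (\<lambda>x. x ^ i * exp (w * x))"
    "\<And>n t. (F n has_real_derivative F (Suc n) t) (at t)"
    "\<And>n t. \<bar>t\<bar> \<le> X \<Longrightarrow> \<bar>F n t\<bar> \<le> fact n * ((X + \<rho>) ^ i * exp (\<bar>w\<bar> * (X + \<rho>))) / \<rho> ^ n"
    by blast
  define B where "B = (X + \<rho>) ^ i * exp (\<bar>w\<bar> * (X + \<rho>))"
  have B: "B \<ge> 0" using assms by (simp add: B_def)
  show ?case
  proof (intro exI[of _ "\<lambda>n x. x * F n x + real n * F (n - 1) x"] conjI allI impI)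
    fix n t
    show "((\<lambda>x. x * F n x + real n * F (n - 1) x) has_real_derivative
            t * F (Suc n) t + real (Suc n) * F (Suc n - 1) t) (at t)"
      by (cases n) (rule derivative_eq_intros F(2) | simp add: algebra_simps)+
    assume t: "\<bar>t\<bar> \<le> X"
    have 1: "\<bar>t * F n t\<bar> \<le> X * (fact n * B / \<rho> ^ n)"
      using F(3)[OF t] t assms unfolding abs_mult B_def by (intro mult_mono) auto
    have 2: "\<bar>real n * F (n - 1) t\<bar> \<le> \<rho> * (fact n * B / \<rho> ^ n)"
    proof (cases n)
      case 0
      then show ?thesis using assms B by simp
    next
      case (Suc m)
      have "\<bar>real n * F (n - 1) t\<bar> \<le> real n * (fact m * B / \<rho> ^ m)"
        using F(3)[OF t, of m] Suc unfolding abs_mult B_def by (intro mult_mono) auto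
      also have "\<dots> = \<rho> * (fact n * B / \<rho> ^ n)"
        using assms by (simp add: Suc fact_Suc del: of_nat_Suc)
      finally show ?thesis .
    qed
    from 1 2 have "\<bar>t * F n t + real n * F (n - 1) t\<bar> \<le> (X + \<rho>) * (fact n * B / \<rho> ^ n)"
      unfolding distrib_right by linarith
    then show "\<bar>t * F n t + real n * F (n - 1) t\<bar>
        \<le> fact n * ((X + \<rho>) ^ Suc i * exp (\<bar>w\<bar> * (X + \<rho>))) / \<rho> ^ n"
      by (simp add: B_def mult_ac)
  qed (simp add: F(1) fun_eq_iff)
qed

text \<open>Induction on the total number of coefficients. Dividing by exp (w i z) and
  differentiating removes one coefficient of \<open>p i\<close> and, by Rolle, loses only one
  zero.\<close>

lemma exponential_polynomial_zeros:
  fixes w :: "'a \<Rightarrow> real" and p :: "'a \<Rightarrow> real poly"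
  assumes "finite J" and inj: "inj_on w J" and "finite Z"
    and "(\<Sum>j\<in>J. if p j = 0 then 0 else Suc (degree (p j))) \<le> card Z"
    and "\<And>z. z \<in> Z \<Longrightarrow> (\<Sum>j\<in>J. poly (p j) z * exp (w j * z)) = 0"
  shows "\<forall>j\<in>J. p j = 0"
  using assms(3-5)
proof (induction "\<Sum>j\<in>J. if p j = 0 then 0 else Suc (degree (p j))" arbitrary: p Z rule: less_induct)
  case less
  define cnt where "cnt q = (if q = 0 then 0 else Suc (degree q))" for q :: "real poly"
  show ?case
  proof (rule ccontr)
    assume "\<not> (\<forall>j\<in>J. p j = 0)"
    then obtain i where i: "i \<in> J" "p i \<noteq> 0" by auto
    \<comment> \<open>Coefficient polynomials of the derivative after division by exp (w i z). For j
      \<noteq> i the leading coefficient is multiplied by w j - w i \<noteq> 0, so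
      \<open>q j\<close> vanishes only if \<open>p j\<close> does; for j = i only
      \<open>pderiv (p i)\<close> is left.\<close>
    define q where "q j = pderiv (p j) + Polynomial.smult (w j - w i) (p j)" for j
    have qdeg: "degree (q j) \<le> degree (p j)" for j
      unfolding q_def by (intro degree_add_le) (auto simp: degree_pderiv)
    have q0: "q j = 0 \<longleftrightarrow> p j = 0" if "j \<in> J" "j \<noteq> i" for j
    proof
      assume "q j = 0"
      then have "coeff (q j) (degree (p j)) = 0" by simp
      moreover have "coeff (pderiv (p j)) (degree (p j)) = 0" by (simp add: coeff_pderiv coeff_eq_0)
      moreover have "w j \<noteq> w i" using inj that i by (auto simp: inj_on_def)
      ultimately show "p j = 0" by (simp add: q_def)
    qed (simp add: q_def)
    have cnt_le: "cnt (q j) \<le> cnt (p j)" if "j \<in> J" for j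
      using qdeg[of j] by (auto simp: cnt_def) (simp add: q_def)
    have cnt_less: "cnt (q i) < cnt (p i)"
      using i by (auto simp: cnt_def q_def degree_pderiv pderiv_eq_0_iff)
    have lt: "(\<Sum>j\<in>J. cnt (q j)) < (\<Sum>j\<in>J. cnt (p j))"
      using cnt_le cnt_less i \<open>finite J\<close> by (intro sum_strict_mono_ex1) auto
    have "Z \<noteq> {}" using lt less.prems(2) by (auto simp: cnt_def)
    moreover define g where "g = (\<lambda>z. \<Sum>j\<in>J. poly (p j) z * exp ((w j - w i) * z))"
    moreover define g' where "g' = (\<lambda>z. \<Sum>j\<in>J. poly (q j) z * exp ((w j - w i) * z))"
    moreover have "(g has_real_derivative g' z) (at z)" for z
      unfolding g_def g'_def q_def
      by (auto intro!: derivative_eq_intros sum.cong simp: algebra_simps)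
    moreover have g: "exp (w i * z) * (\<Sum>j\<in>J. poly (r j) z * exp ((w j - w i) * z)) =
        (\<Sum>j\<in>J. poly (r j) z * exp (w j * z))" for z and r :: "'a \<Rightarrow> real poly"
      by (simp add: sum_distrib_left algebra_simps flip: exp_add)
    moreover have "g z = 0" if "z \<in> Z" for z
      using g[of z p] less.prems(3)[OF that] by (simp add: g_def)
    ultimately obtain Z' where Z': "finite Z'" "card Z = Suc (card Z')" "\<forall>z\<in>Z'. g' z = 0"
      using rolle_finite[OF less.prems(1), of g g'] by blast
    have "\<forall>j\<in>J. q j = 0"
    proof (rule less.hyps)
      show "finite Z'" by fact
      show "(\<Sum>j\<in>J. poly (q j) z * exp (w j * z)) = 0" if "z \<in> Z'" for z
        using g[of z q] Z' that by (simp add: g'_def)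
    qed (use lt less.prems(2) Z' in \<open>simp_all add: cnt_def\<close>)
    \<comment> \<open>What remains is a constant times one exponential, and a single zero in
      \<open>Z\<close> makes that constant 0.\<close>
    then have "pderiv (p i) = 0" and *: "\<And>j. j \<in> J \<Longrightarrow> j \<noteq> i \<Longrightarrow> p j = 0"
      using i q0 by (auto simp: q_def)
    then have "degree (p i) = 0" by (simp add: pderiv_eq_0_iff)
    then obtain c where c: "p i = [:c:]" by (rule degree_eq_zeroE)
    obtain z where "z \<in> Z" using \<open>Z \<noteq> {}\<close> by auto
    have "(\<Sum>j\<in>J. poly (p j) z * exp (w j * z)) = (\<Sum>j\<in>{i}. poly (p j) z * exp (w j * z))"
      using i * \<open>finite J\<close> by (intro sum.mono_neutral_right) auto
    then show False using less.prems(3)[OF \<open>z \<in> Z\<close>] c i by simp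
  qed
qed

section \<open>Heights via integer matrices\<close>

text \<open>
  \<open>int_rep I e H x\<close>: the vector \<open>e\<close> is an eigenvector for \<open>x\<close> of an integer matrix with row sums at
  most \<open>H\<close>. Such pairs \<open>(H, x)\<close> add and multiply without any commutation or independence condition,
  so \<open>H\<close> serves as a height on the ring generated by given algebraic numbers.
\<close>
definition int_rep :: "'a set \<Rightarrow> ('a \<Rightarrow> real) \<Rightarrow> real \<Rightarrow> real \<Rightarrow> bool" where
  "int_rep I e H x \<longleftrightarrow> (\<exists>c :: 'a \<Rightarrow> 'a \<Rightarrow> int. \<forall>i\<in>I.
     x * e i = (\<Sum>k\<in>I. of_int (c i k) * e k) \<and> (\<Sum>k\<in>I. \<bar>of_int (c i k) :: real\<bar>) \<le> H)"

lemma int_repE: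
  fixes e :: "'a \<Rightarrow> real"
  assumes "int_rep I e H x"
  obtains c :: "'a \<Rightarrow> 'a \<Rightarrow> int"
    where "\<And>i. i \<in> I \<Longrightarrow> x * e i = (\<Sum>k\<in>I. of_int (c i k) * e k)"
      and "\<And>i. i \<in> I \<Longrightarrow> (\<Sum>k\<in>I. \<bar>of_int (c i k) :: real\<bar>) \<le> H"
  using assms unfolding int_rep_def by blast

lemma int_rep_mono: "int_rep I e H x \<Longrightarrow> H \<le> H' \<Longrightarrow> int_rep I e H' x"
  unfolding int_rep_def by (elim exE, rule exI) (auto intro: order_trans)

lemma int_rep_of_int:
  assumes "finite I"
  shows "int_rep I e \<bar>of_int a\<bar> (of_int a)"
  unfolding int_rep_def
  by (rule exI[of _ "\<lambda>i k. if k = i then a else 0"])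
     (use assms in \<open>auto simp: if_distrib[of of_int] if_distrib[of abs] if_distrib[of "\<lambda>x. x * _"]
        sum.delta cong: if_cong\<close>)

lemma int_rep_add:
  assumes "int_rep I e H x" "int_rep I e H' y"
  shows "int_rep I e (H + H') (x + y)"
proof -
  obtain c where
    c: "\<And>i. i \<in> I \<Longrightarrow> x * e i = (\<Sum>k\<in>I. of_int (c i k) * e k)"
       "\<And>i. i \<in> I \<Longrightarrow> (\<Sum>k\<in>I. \<bar>of_int (c i k :: int) :: real\<bar>) \<le> H"
    using int_repE[OF assms(1)] by blast
  obtain d where
    d: "\<And>i. i \<in> I \<Longrightarrow> y * e i = (\<Sum>k\<in>I. of_int (d i k) * e k)"
       "\<And>i. i \<in> I \<Longrightarrow> (\<Sum>k\<in>I. \<bar>of_int (d i k :: int) :: real\<bar>) \<le> H'"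
    using int_repE[OF assms(2)] by blast
  show ?thesis unfolding int_rep_def
  proof (intro exI[of _ "\<lambda>i k. c i k + d i k"] ballI conjI)
    fix i assume i: "i \<in> I"
    show "(x + y) * e i = (\<Sum>k\<in>I. of_int (c i k + d i k) * e k)"
      using c(1) d(1) i by (simp add: distrib_right sum.distrib)
    have "(\<Sum>k\<in>I. \<bar>of_int (c i k + d i k) :: real\<bar>) \<le>
        (\<Sum>k\<in>I. \<bar>of_int (c i k) :: real\<bar> + \<bar>of_int (d i k) :: real\<bar>)"
      by (intro sum_mono) (simp add: abs_triangle_ineq)
    then show "(\<Sum>k\<in>I. \<bar>of_int (c i k + d i k) :: real\<bar>) \<le> H + H'"
      using c(2)[OF i] d(2)[OF i] by (simp add: sum.distrib)
  qed
qed

text \<open>The witness is the product of the two matrices. Row sums are bounded, rather than single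
  entries, because the row sum norm is submultiplicative.\<close>

lemma int_rep_mult:
  assumes "int_rep I e H x" "int_rep I e H' y" "H \<ge> 0" "H' \<ge> 0"
  shows "int_rep I e (H * H') (x * y)"
proof -
  obtain c where
    c: "\<And>i. i \<in> I \<Longrightarrow> x * e i = (\<Sum>k\<in>I. of_int (c i k) * e k)"
       "\<And>i. i \<in> I \<Longrightarrow> (\<Sum>k\<in>I. \<bar>of_int (c i k :: int) :: real\<bar>) \<le> H"
    using int_repE[OF assms(1)] by blast
  obtain d where
    d: "\<And>i. i \<in> I \<Longrightarrow> y * e i = (\<Sum>k\<in>I. of_int (d i k) * e k)"
       "\<And>i. i \<in> I \<Longrightarrow> (\<Sum>k\<in>I. \<bar>of_int (d i k :: int) :: real\<bar>) \<le> H'"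
    using int_repE[OF assms(2)] by blast
  show ?thesis unfolding int_rep_def
  proof (intro exI[of _ "\<lambda>i l. \<Sum>k\<in>I. d i k * c k l"] ballI conjI)
    fix i assume i: "i \<in> I"
    have "x * y * e i = (\<Sum>k\<in>I. of_int (d i k) * (x * e k))"
      using d(1)[OF i] by (simp add: sum_distrib_left mult_ac)
    also have "\<dots> = (\<Sum>k\<in>I. \<Sum>l\<in>I. of_int (d i k) * of_int (c k l) * e l)"
      by (intro sum.cong refl) (simp add: c(1) sum_distrib_left mult_ac)
    also have "\<dots> = (\<Sum>l\<in>I. of_int (\<Sum>k\<in>I. d i k * c k l) * e l)"
      by (subst sum.swap) (simp add: sum_distrib_right)
    finally show "x * y * e i = (\<Sum>l\<in>I. of_int (\<Sum>k\<in>I. d i k * c k l) * e l)" .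
    have "(\<Sum>l\<in>I. \<bar>of_int (\<Sum>k\<in>I. d i k * c k l) :: real\<bar>) \<le>
        (\<Sum>l\<in>I. \<Sum>k\<in>I. \<bar>of_int (d i k)\<bar> * \<bar>of_int (c k l)\<bar>)"
      by (intro sum_mono) (simp add: order.trans[OF sum_abs] abs_mult)
    also have "\<dots> = (\<Sum>k\<in>I. \<bar>of_int (d i k)\<bar> * (\<Sum>l\<in>I. \<bar>of_int (c k l)\<bar>))"
      by (subst sum.swap) (simp add: sum_distrib_left)
    also have "\<dots> \<le> (\<Sum>k\<in>I. \<bar>of_int (d i k)\<bar> * H)"
      by (intro sum_mono mult_left_mono c(2)) auto
    also have "\<dots> \<le> H' * H"
      unfolding sum_distrib_right[symmetric] using d(2)[OF i] assms by (intro mult_right_mono) auto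
    finally show "(\<Sum>l\<in>I. \<bar>of_int (\<Sum>k\<in>I. d i k * c k l) :: real\<bar>) \<le> H * H'"
      by (simp add: mult.commute)
  qed
qed

lemma int_rep_of_nat: "finite I \<Longrightarrow> int_rep I e (of_nat a) (of_nat a)"
  using int_rep_of_int[of I e "int a"] by simp

lemma int_rep_1: "finite I \<Longrightarrow> int_rep I e 1 1"
  using int_rep_of_nat[of I e 1] by simp

lemma int_rep_sum:
  assumes "finite I" "\<And>a. a \<in> A \<Longrightarrow> int_rep I e (H a) (f a)"
  shows "int_rep I e (\<Sum>a\<in>A. H a) (\<Sum>a\<in>A. f a)"
  using assms(2)
  by (induction A rule: infinite_finite_induct)
     (use int_rep_of_nat[OF assms(1), of e 0] in \<open>auto intro: int_rep_add\<close>)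

lemma int_rep_prod:
  assumes "finite I" "\<And>a. a \<in> A \<Longrightarrow> int_rep I e (H a) (f a)" "\<And>a. a \<in> A \<Longrightarrow> H a \<ge> 0"
  shows "int_rep I e (\<Prod>a\<in>A. H a) (\<Prod>a\<in>A. f a)"
  using assms(2,3)
  by (induction A rule: infinite_finite_induct)
     (use int_rep_1[OF assms(1), of e] in \<open>auto intro!: int_rep_mult prod_nonneg\<close>)

lemma int_rep_power:
  assumes "finite I" "int_rep I e H x" "H \<ge> 0"
  shows "int_rep I e (H ^ n) (x ^ n)"
  using int_rep_prod[of I "{..<n}" e "\<lambda>_. H" "\<lambda>_. x"] assms by simp

lemma signof_cases:
  obtains "signof p = (1 :: 'a :: comm_ring_1)" | "signof p = (-1 :: 'a)"
  by (cases "evenperm p") (auto simp: sign_def)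

text \<open>The Leibniz formula has \<open>fact n\<close> terms, each a sign times n
  entries.\<close>

lemma int_rep_det:
  assumes "finite I" and A: "A \<in> carrier_mat n n"
    and "\<And>i j. i < n \<Longrightarrow> j < n \<Longrightarrow> int_rep I e H (A $$ (i, j))" "H \<ge> 0"
  shows "int_rep I e (fact n * H ^ n) (Determinant.det A)"
proof -
  have "int_rep I e (\<Sum>p | p permutes {0..<n}. 1 * (\<Prod>i = 0..<n. H))
          (\<Sum>p | p permutes {0..<n}. signof p * (\<Prod>i = 0..<n. A $$ (i, p i)))"
  proof (intro int_rep_sum int_rep_mult int_rep_prod)
    fix p assume "p \<in> {p. p permutes {0..<n}}"
    then show "int_rep I e H (A $$ (i, p i))" if "i \<in> {0..<n}" for i
      using that assms(3) permutes_in_image[of p "{0..<n}" i] by auto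
    show "int_rep I e 1 (signof p)"
      by (rule signof_cases[of p, where 'a = real])
         (use int_rep_1[of I e] int_rep_of_int[of I e "-1"] assms(1) in auto)
  qed (use assms in \<open>auto intro: prod_nonneg\<close>)
  then show ?thesis by (simp add: det_def'[OF A] card_permutations)
qed

section \<open>The l1 norm of integer polynomials and a Liouville inequality\<close>

definition poly_l1 :: "int poly \<Rightarrow> real" where
  "poly_l1 p = (\<Sum>a\<leftarrow>coeffs p. \<bar>of_int a\<bar>)"

lemma poly_l1_0 [simp]: "poly_l1 0 = 0"
  by (simp add: poly_l1_def)

lemma poly_l1_pCons [simp]: "poly_l1 (pCons a p) = \<bar>of_int a\<bar> + poly_l1 p"
  by (simp add: poly_l1_def cCons_def)

lemma poly_l1_1 [simp]: "poly_l1 1 = 1"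
  by (simp add: one_pCons)

lemma poly_l1_nonneg: "poly_l1 p \<ge> 0"
  by (induction p) auto

lemma poly_l1_smult: "poly_l1 (Polynomial.smult a p) = \<bar>of_int a\<bar> * poly_l1 p"
  by (induction p) (auto simp: abs_mult algebra_simps)

lemma poly_l1_add: "poly_l1 (p + q) \<le> poly_l1 p + poly_l1 q"
  by (induction p q rule: poly_induct2) auto

lemma poly_l1_mult: "poly_l1 (p * q) \<le> poly_l1 p * poly_l1 q"
proof (induction p)
  case (pCons a p)
  have "poly_l1 (pCons a p * q) \<le> \<bar>of_int a\<bar> * poly_l1 q + poly_l1 (p * q)"
    using poly_l1_add[of "Polynomial.smult a q" "pCons 0 (p * q)"] by (simp add: poly_l1_smult)
  then show ?case using pCons.IH by (simp add: algebra_simps)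
qed simp

lemma poly_l1_sum: "poly_l1 (\<Sum>a\<in>A. f a) \<le> (\<Sum>a\<in>A. poly_l1 (f a))"
  by (induction A rule: infinite_finite_induct) (auto intro: order.trans[OF poly_l1_add])

lemma poly_l1_prod: "poly_l1 (\<Prod>a\<in>A. f a) \<le> (\<Prod>a\<in>A. poly_l1 (f a))"
  by (induction A rule: infinite_finite_induct)
     (auto intro!: order.trans[OF poly_l1_mult] mult_left_mono poly_l1_nonneg simp: one_pCons)

lemma poly_le_poly_l1:
  assumes "\<bar>x\<bar> \<le> (1 :: real)"
  shows "\<bar>poly (map_poly of_int p) x\<bar> \<le> poly_l1 p"
proof (induction p)
  case (pCons a p)
  have "\<bar>x * poly (map_poly of_int p) x\<bar> \<le> 1 * poly_l1 p"
    unfolding abs_mult using assms pCons.IH by (intro mult_mono) auto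
  then show ?case by (simp add: of_int_hom.map_poly_pCons_hom)
qed simp

text \<open>Factors X of \<open>p\<close> can be cancelled because x \<noteq> 0. Then the constant
  coefficient is a nonzero integer equal to -x times the value of the remaining polynomial, and that
  value is at most its l1 norm as |x| \<le> 1.\<close>

lemma int_poly_root_lower_bound:
  fixes x :: real
  assumes "p \<noteq> 0" "poly (map_poly of_int p) x = 0" "x \<noteq> 0" "\<bar>x\<bar> \<le> 1"
  shows "1 \<le> poly_l1 p * \<bar>x\<bar>"
  using assms(1,2)
proof (induction p)
  case (pCons a p)
  show ?case
  proof (cases "a = 0")
    case True
    then show ?thesis using pCons assms(3) by (simp add: of_int_hom.map_poly_pCons_hom)
  next
    case False
    have "of_int a = - x * poly (map_poly of_int p) x"
      using pCons.prems(2) by (simp add: of_int_hom.map_poly_pCons_hom)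
    then have "\<bar>of_int a\<bar> = \<bar>x\<bar> * \<bar>poly (map_poly of_int p) x\<bar>" by (simp add: abs_mult)
    also have "\<dots> \<le> \<bar>x\<bar> * poly_l1 p" by (intro mult_left_mono poly_le_poly_l1 assms(4)) auto
    finally have "\<bar>of_int a\<bar> \<le> poly_l1 p * \<bar>x\<bar>" by (simp add: mult.commute)
    moreover have "(1 :: real) \<le> \<bar>of_int a\<bar>" using False by linarith
    ultimately have "1 \<le> poly_l1 p * \<bar>x\<bar>" by linarith
    then show ?thesis using assms(3) by (simp add: algebra_simps)
       (smt (verit) abs_ge_zero mult_nonneg_nonneg of_int_abs)
  qed
qed simp

text \<open>Leibniz expansion of det (X - Q). A diagonal entry has norm at most H + 1, which is at
  most 2 H since H \<ge> 1.\<close>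

lemma poly_l1_char_poly:
  assumes Q: "Q \<in> carrier_mat n n" and "\<And>i k. i < n \<Longrightarrow> k < n \<Longrightarrow> \<bar>of_int (Q $$ (i, k))\<bar> \<le> H" "H \<ge> 1"
  shows "poly_l1 (char_poly Q) \<le> fact n * (2 * H) ^ n"
proof -
  let ?M = "char_poly_matrix Q"
  have M: "?M \<in> carrier_mat n n" using Q by simp
  have entry: "poly_l1 (?M $$ (i, k)) \<le> 2 * H" if "i < n" "k < n" for i k
    using assms(2)[OF that] assms(3) that Q by (auto simp: char_poly_matrix_def)
  have "poly_l1 (char_poly Q) \<le>
      (\<Sum>p | p permutes {0..<n}. poly_l1 (signof p * (\<Prod>i = 0..<n. ?M $$ (i, p i))))"
    unfolding char_poly_def det_def'[OF M] by (rule poly_l1_sum)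
  also have "\<dots> \<le> (\<Sum>p | p permutes {0..<n}. (2 * H) ^ n)"
  proof (intro sum_mono)
    fix p assume p: "p \<in> {p. p permutes {0..<n}}"
    have s: "poly_l1 (signof p) = 1"
      by (rule signof_cases[of p, where 'a = "int poly"]) (auto simp: one_pCons)
    have "poly_l1 (signof p * (\<Prod>i = 0..<n. ?M $$ (i, p i))) \<le> 1 * (\<Prod>i = 0..<n. poly_l1 (?M $$ (i, p i)))"
      unfolding s[symmetric] by (intro order.trans[OF poly_l1_mult] mult_left_mono poly_l1_prod poly_l1_nonneg)
    also have "\<dots> \<le> 1 * (\<Prod>i = 0..<n. 2 * H)"
      using p permutes_in_image[of p "{0..<n}"]
      by (intro mult_left_mono prod_mono conjI poly_l1_nonneg entry) auto
    finally show "poly_l1 (signof p * (\<Prod>i = 0..<n. ?M $$ (i, p i))) \<le> (2 * H) ^ n" by simp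
  qed
  finally show ?thesis by (simp add: card_permutations)
qed

text \<open>Since \<open>e i0\<close> is nonzero, \<open>e\<close> is a genuine eigenvector, so x is
  a root of the monic integer characteristic polynomial and the Liouville bound for roots
  applies.\<close>

lemma int_rep_lower_bound:
  assumes "finite I" "i0 \<in> I" "e i0 \<noteq> 0" "int_rep I e H x" "x \<noteq> 0" "H \<ge> 1"
  shows "1 \<le> fact (card I) * (2 * H) ^ card I * \<bar>x\<bar>"
proof (cases "\<bar>x\<bar> \<le> 1")
  case False
  have "(1::real) * 1 * 1 \<le> fact (card I) * (2 * H) ^ card I * \<bar>x\<bar>"
    using False assms(6) by (intro mult_mono one_le_power) auto
  then show ?thesis by simp
next
  case True
  define n where "n = card I"
  obtain h where h: "bij_betw h {0..<n} I"
    using ex_bij_betw_nat_finite[OF assms(1)] by (auto simp: n_def)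
  obtain c where
    c: "\<And>i. i \<in> I \<Longrightarrow> x * e i = (\<Sum>k\<in>I. of_int (c i k) * e k)"
       "\<And>i. i \<in> I \<Longrightarrow> (\<Sum>k\<in>I. \<bar>of_int (c i k :: int) :: real\<bar>) \<le> H"
    using int_repE[OF assms(4)] by blast
  \<comment> \<open>The matrix indexed by \<open>I\<close> is renumbered along the bijection
    \<open>h\<close>.\<close>
  define Q where "Q = mat n n (\<lambda>(i, k). c (h i) (h k))"
  define v where "v = vec n (\<lambda>i. e (h i))"
  have Q: "Q \<in> carrier_mat n n" by (simp add: Q_def)
  have hI: "h i \<in> I" if "i < n" for i using h that by (auto simp: bij_betw_def)
  let ?R = "map_mat of_int Q :: real mat"
  have R: "?R \<in> carrier_mat n n" using Q by simp
  have "eigenvector ?R v x"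
    unfolding eigenvector_def
  proof (intro conjI)
    show "v \<in> carrier_vec (dim_row ?R)" using Q by (simp add: v_def)
    obtain j where "j < n" "h j = i0" using h assms(2) by (auto simp: bij_betw_def)
    then have "vec_index v j \<noteq> vec_index (0\<^sub>v (dim_row ?R)) j" using assms(3) Q by (simp add: v_def)
    then show "v \<noteq> 0\<^sub>v (dim_row ?R)" by metis
    show "?R *\<^sub>v v = x \<cdot>\<^sub>v v"
    proof (rule eq_vecI)
      fix i assume "i < dim_vec (x \<cdot>\<^sub>v v)"
      then have i: "i < n" by (simp add: v_def)
      have "vec_index (?R *\<^sub>v v) i = (\<Sum>k = 0..<n. of_int (c (h i) (h k)) * e (h k))"
        using i by (simp add: Q_def v_def scalar_prod_def)
      also have "\<dots> = x * e (h i)"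
        unfolding c(1)[OF hI[OF i]] by (rule sum.reindex_bij_betw[OF h])
      finally show "vec_index (?R *\<^sub>v v) i = vec_index (x \<cdot>\<^sub>v v) i" using i by (simp add: v_def)
    qed (simp add: Q_def v_def)
  qed
  then have "poly (char_poly ?R) x = 0"
    using eigenvalue_root_char_poly[OF R] by (auto simp: eigenvalue_def)
  then have "poly (map_poly of_int (char_poly Q)) x = 0"
    by (simp add: of_int_hom.char_poly_hom[OF Q])
  moreover have "char_poly Q \<noteq> 0" using degree_monic_char_poly[OF Q] by auto
  ultimately have "1 \<le> poly_l1 (char_poly Q) * \<bar>x\<bar>"
    using int_poly_root_lower_bound True assms(5) by blast
  also have "\<dots> \<le> fact n * (2 * H) ^ n * \<bar>x\<bar>"
  proof (intro mult_right_mono poly_l1_char_poly[OF Q])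
    fix i k assume ik: "i < n" "k < n"
    have "\<bar>of_int (c (h i) (h k)) :: real\<bar> \<le> (\<Sum>k\<in>I. \<bar>of_int (c (h i) k)\<bar>)"
      using hI ik assms(1) by (intro member_le_sum) auto
    then show "\<bar>of_int (Q $$ (i, k))\<bar> \<le> H" using c(2)[OF hI[OF ik(1)]] ik by (simp add: Q_def)
  qed (use assms in auto)
  finally show ?thesis by (simp add: n_def)
qed

section \<open>Integer matrices for given algebraic numbers\<close>

text \<open>Adjoins the powers \<alpha>^k below the degree n of an integer polynomial with root
  \<alpha>. If a is its leading coefficient, then a \<alpha> acts by an integer companion matrix,
  while the earlier numbers act on each power separately. The denominator d is |a|.\<close>

lemma int_rep_extend:
  assumes "finite I" "algebraic \<alpha>"
  obtains n d H where "n > 0" "d > (0::nat)"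
    "int_rep (I \<times> {..<n}) (\<lambda>(i, k). e i * \<alpha> ^ k) H (real d * \<alpha>)"
    "\<And>H x. int_rep I e H x \<Longrightarrow> int_rep (I \<times> {..<n}) (\<lambda>(i, k). e i * \<alpha> ^ k) H x"
proof -
  obtain p where p: "p \<noteq> 0" "poly (map_poly of_int p) \<alpha> = 0"
    using algebraicE'[OF assms(2)] by blast
  define n where "n = degree p"
  define a where "a = lead_coeff p"
  define e' where "e' = (\<lambda>(i, k). e i * \<alpha> ^ k)"
  have n: "n > 0"
  proof (rule ccontr)
    assume "\<not> n > 0"
    then obtain c where "p = [:c:]" by (auto simp: n_def elim: degree_eq_zeroE)
    then show False using p by (simp add: of_int_hom.map_poly_pCons_hom)
  qed
  have root: "(\<Sum>m<n. of_int (coeff p m) * \<alpha> ^ m) = - of_int a * \<alpha> ^ n"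
  proof -
    have "poly (map_poly of_int p) \<alpha> = (\<Sum>m\<le>n. of_int (coeff p m) * \<alpha> ^ m)"
      by (simp add: poly_altdef n_def coeff_map_poly degree_map_poly)
    then show ?thesis using p by (simp add: a_def n_def flip: lessThan_Suc_atMost)
  qed
  \<comment> \<open>Companion matrix in each block: a times the shift to the next power, and for the
    last power the relation that expresses a \<alpha>^n through lower powers.\<close>
  define c where "c = (\<lambda>(i::'a, k) (i', k'). if i' = i then if Suc k < n then if k' = Suc k then a else 0
       else - coeff p k' else 0)"
  have rep: "int_rep (I \<times> {..<n}) e' (\<Sum>m\<le>n. \<bar>of_int (coeff p m)\<bar>) (of_int a * \<alpha>)"
    unfolding int_rep_def
  proof (rule exI[of _ c], safe)
    fix i k assume i: "i \<in> I" "k < n"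
    \<comment> \<open>Only the block of i contributes. The statement is general in \<open>f\<close>
      so as to cover both the weighted sum and the row sum of absolute values.\<close>
    have red: "(\<Sum>z\<in>I \<times> {..<n}. f (c (i, k) z) z) = (\<Sum>k'<n. f (c (i, k) (i, k')) (i, k'))"
      if "\<And>z. f 0 z = 0" for f :: "int \<Rightarrow> 'a \<times> nat \<Rightarrow> real"
    proof -
      have "(\<Sum>z\<in>I \<times> {..<n}. f (c (i, k) z) z) = (\<Sum>i'\<in>I. \<Sum>k'<n. f (c (i, k) (i', k')) (i', k'))"
        by (simp add: sum.cartesian_product)
      also have "\<dots> = (\<Sum>i'\<in>{i}. \<Sum>k'<n. f (c (i, k) (i', k')) (i', k'))"
        using i assms(1) by (intro sum.mono_neutral_right) (auto simp: c_def that)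
      finally show ?thesis by simp
    qed
    have "(\<Sum>z\<in>I \<times> {..<n}. of_int (c (i, k) z) * e' z) = (\<Sum>k'<n. of_int (c (i, k) (i, k')) * e' (i, k'))"
      by (rule red[of "\<lambda>a z. of_int a * e' z"]) simp
    also have "\<dots> = of_int a * \<alpha> * e' (i, k)"
    proof (cases "Suc k < n")
      case True
      then show ?thesis
        by (simp add: c_def e'_def if_distrib[of of_int] if_distrib[of "\<lambda>x. x * _"] sum.delta cong: if_cong)
    next
      case False
      then have k: "n = Suc k" using i by auto
      have "(\<Sum>k'<n. of_int (c (i, k) (i, k')) * e' (i, k')) = - e i * (\<Sum>m<n. of_int (coeff p m) * \<alpha> ^ m)"
        using False by (simp add: c_def e'_def sum_distrib_left sum_negf mult_ac)
      then show ?thesis unfolding root by (simp add: k e'_def)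
    qed
    finally show "of_int a * \<alpha> * e' (i, k) = (\<Sum>z\<in>I \<times> {..<n}. of_int (c (i, k) z) * e' z)" ..
    have "(\<Sum>z\<in>I \<times> {..<n}. \<bar>of_int (c (i, k) z)\<bar>) = (\<Sum>k'<n. \<bar>of_int (c (i, k) (i, k'))\<bar> :: real)"
      by (rule red[of "\<lambda>a z. \<bar>of_int a\<bar>"]) simp
    also have "\<dots> \<le> (\<Sum>m\<le>n. \<bar>of_int (coeff p m)\<bar>)"
    proof (cases "Suc k < n")
      case True
      then have "(\<Sum>k'<n. \<bar>of_int (c (i, k) (i, k'))\<bar> :: real) = \<bar>of_int a\<bar>"
        by (simp add: c_def if_distrib[of of_int] if_distrib[of abs] sum.delta cong: if_cong)
      also have "\<dots> \<le> (\<Sum>m\<le>n. \<bar>of_int (coeff p m)\<bar>)"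
        unfolding a_def n_def by (rule member_le_sum[where f = "\<lambda>m. \<bar>of_int (coeff p m)\<bar>"]) auto
      finally show ?thesis .
    next
      case False
      then show ?thesis by (auto simp: c_def intro!: sum_mono2)
    qed
    finally show "(\<Sum>z\<in>I \<times> {..<n}. \<bar>of_int (c (i, k) z)\<bar>) \<le> (\<Sum>m\<le>n. \<bar>of_int (coeff p m)\<bar> :: real)" .
  qed
  define H where "H = (\<Sum>m\<le>n. \<bar>of_int (coeff p m)\<bar> :: real)"
  have "H \<ge> 0" by (simp add: H_def sum_nonneg)
  \<comment> \<open>Multiplying by the sign of a makes the denominator positive and does not
    increase the bound.\<close>
  have "int_rep (I \<times> {..<n}) e' (1 * H) (of_int (sgn a) * (of_int a * \<alpha>))"
    using int_rep_of_int[of "I \<times> {..<n}" e' "sgn a"] rep assms(1) \<open>H \<ge> 0\<close>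
    by (intro int_rep_mult int_rep_mono[of _ _ "\<bar>of_int (sgn a)\<bar>" _ 1])
       (auto simp: H_def sgn_if)
  moreover have "of_int (sgn a) * (of_int a * \<alpha>) = real (nat \<bar>a\<bar>) * \<alpha>"
    by (simp add: sgn_if)
  ultimately have 1: "int_rep (I \<times> {..<n}) e' (1 * H) (real (nat \<bar>a\<bar>) * \<alpha>)" by simp
  have 2: "nat \<bar>a\<bar> > 0" using p by (simp add: a_def)
  have 3: "int_rep (I \<times> {..<n}) e' H x" if x: "int_rep I e H x" for H x
  proof -
    obtain c where
      c: "\<And>i. i \<in> I \<Longrightarrow> x * e i = (\<Sum>k\<in>I. of_int (c i k) * e k)"
         "\<And>i. i \<in> I \<Longrightarrow> (\<Sum>k\<in>I. \<bar>of_int (c i k :: int) :: real\<bar>) \<le> H"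
      using int_repE[OF x] by blast
    \<comment> \<open>The old matrix acts on the first index and the identity on the
      exponent.\<close>
    define c' where "c' = (\<lambda>(i, k::nat) (i', k'). if k' = k then c i i' else 0)"
    show ?thesis unfolding int_rep_def
    proof (rule exI[of _ c'], safe)
      fix i k assume i: "i \<in> I" "k < n"
      have red: "(\<Sum>z\<in>I \<times> {..<n}. f (c' (i, k) z) z) = (\<Sum>i'\<in>I. f (c i i') (i', k))"
        if "\<And>z. f 0 z = 0" for f :: "int \<Rightarrow> 'a \<times> nat \<Rightarrow> real"
      proof -
        have "(\<Sum>z\<in>I \<times> {..<n}. f (c' (i, k) z) z) = (\<Sum>i'\<in>I. \<Sum>k'<n. f (c' (i, k) (i', k')) (i', k'))"
          by (simp add: sum.cartesian_product)
        also have "\<dots> = (\<Sum>i'\<in>I. \<Sum>k'\<in>{k}. f (c' (i, k) (i', k')) (i', k'))"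
          using i by (intro sum.cong sum.mono_neutral_right) (auto simp: c'_def that)
        finally show ?thesis by (simp add: c'_def)
      qed
      have "(\<Sum>z\<in>I \<times> {..<n}. of_int (c' (i, k) z) * e' z) = (\<Sum>i'\<in>I. of_int (c i i') * e' (i', k))"
        by (rule red[of "\<lambda>a z. of_int a * e' z"]) simp
      also have "\<dots> = (\<Sum>i'\<in>I. of_int (c i i') * e i') * \<alpha> ^ k"
        unfolding e'_def sum_distrib_right by (simp add: mult_ac)
      finally show "x * e' (i, k) = (\<Sum>z\<in>I \<times> {..<n}. of_int (c' (i, k) z) * e' z)"
        using c(1)[OF i(1)] by (simp add: e'_def)
      show "(\<Sum>z\<in>I \<times> {..<n}. \<bar>of_int (c' (i, k) z)\<bar>) \<le> H"
        using red[of "\<lambda>a z. \<bar>of_int a\<bar>"] c(2)[OF i(1)] by simp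
    qed
  qed
  show ?thesis by (rule that[of n "nat \<bar>a\<bar>" "1 * H"]) (use n 1 2 3 in \<open>simp_all add: e'_def\<close>)
qed

text \<open>Starts from one index with value 1 and adjoins \<alpha>, \<beta> and \<gamma> in turn,
  whence the nested index type. The product of the three denominators is a common one.\<close>

lemma int_rep_three_algebraics:
  assumes "algebraic \<alpha>" "algebraic \<beta>" "algebraic \<gamma>"
  obtains I :: "(((unit \<times> nat) \<times> nat) \<times> nat) set" and e i d H where
    "finite I" "i \<in> I" "e i \<noteq> 0" "d > (0 :: nat)" "H \<ge> 1"
    "int_rep I e H d" "int_rep I e H (d * \<alpha>)" "int_rep I e H (d * \<beta>)" "int_rep I e H (d * \<gamma>)"
proof -
  obtain n1 d1 H1 where 1: "n1 > 0" "d1 > (0::nat)"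
    "int_rep ({()} \<times> {..<n1}) (\<lambda>(i, k). (\<lambda>_. 1) i * \<alpha> ^ k) H1 (real d1 * \<alpha>)"
    by (rule int_rep_extend[OF _ assms(1), of "{()}" "\<lambda>_. 1"]) auto
  define I1 where "I1 = {()} \<times> {..<n1}"
  define e1 :: "unit \<times> nat \<Rightarrow> real" where "e1 = (\<lambda>(i, k). (\<lambda>_. 1) i * \<alpha> ^ k :: real)"
  obtain n2 d2 H2 where 2: "n2 > 0" "d2 > (0::nat)"
    "int_rep (I1 \<times> {..<n2}) (\<lambda>(i, k). e1 i * \<beta> ^ k) H2 (real d2 * \<beta>)"
    "\<And>H x. int_rep I1 e1 H x \<Longrightarrow> int_rep (I1 \<times> {..<n2}) (\<lambda>(i, k). e1 i * \<beta> ^ k) H x"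
    by (rule int_rep_extend[OF _ assms(2), of I1 e1]) (auto simp: I1_def)
  define I2 where "I2 = I1 \<times> {..<n2}"
  define e2 where "e2 = (\<lambda>(i, k). e1 i * \<beta> ^ k)"
  obtain n3 d3 H3 where 3: "n3 > 0" "d3 > (0::nat)"
    "int_rep (I2 \<times> {..<n3}) (\<lambda>(i, k). e2 i * \<gamma> ^ k) H3 (real d3 * \<gamma>)"
    "\<And>H x. int_rep I2 e2 H x \<Longrightarrow> int_rep (I2 \<times> {..<n3}) (\<lambda>(i, k). e2 i * \<gamma> ^ k) H x"
    by (rule int_rep_extend[OF _ assms(3), of I2 e2]) (auto simp: I2_def I1_def)
  define I where "I = I2 \<times> {..<n3}"
  define e where "e = (\<lambda>(i, k). e2 i * \<gamma> ^ k)"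
  have fin: "finite I" by (simp add: I_def I2_def I1_def)
  define H where "H = real (d1 * d2 * d3) * (1 + \<bar>H1\<bar> + \<bar>H2\<bar> + \<bar>H3\<bar>)"
  have a: "int_rep I e H1 (d1 * \<alpha>)" using 1 2 3 by (simp add: I_def I2_def I1_def e_def e2_def e1_def)
  have b: "int_rep I e H2 (d2 * \<beta>)" using 2 3 by (simp add: I_def I2_def e_def e2_def)
  have c: "int_rep I e H3 (d3 * \<gamma>)" using 3 by (simp add: I_def e_def)
  \<comment> \<open>Passing from the denominator d' to the common one multiplies by the integer
    cofactor m, at a cost of m \<le> d1 d2 d3; this is the factor in \<open>H\<close>.\<close>
  have rep: "int_rep I e H (real (d1 * d2 * d3) * x)"
    if "int_rep I e H' (real d' * x)" "d1 * d2 * d3 = m * d'" "d' > 0" "\<bar>H'\<bar> \<le> 1 + \<bar>H1\<bar> + \<bar>H2\<bar> + \<bar>H3\<bar>" for x H' m d'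
  proof -
    have "int_rep I e (real m * (1 + \<bar>H1\<bar> + \<bar>H2\<bar> + \<bar>H3\<bar>)) (real m * (real d' * x))"
      using that fin by (intro int_rep_mult int_rep_of_nat int_rep_mono[OF that(1)]) auto
    moreover have "real m * (1 + \<bar>H1\<bar> + \<bar>H2\<bar> + \<bar>H3\<bar>) \<le> H"
    proof -
      have "m \<le> d1 * d2 * d3" using that by simp
      then show ?thesis unfolding H_def by (intro mult_right_mono) (auto simp del: of_nat_mult)
    qed
    moreover have "real (d1 * d2 * d3) * x = real m * (real d' * x)"
      unfolding that(2) of_nat_mult by (rule mult.assoc)
    ultimately show ?thesis by (metis int_rep_mono)
  qed
  show ?thesis
  \<comment> \<open>The chosen index belongs to \<alpha>^0 \<beta>^0 \<gamma>^0 = 1, so the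
    eigenvector has a nonzero coordinate.\<close>
  proof (rule that[of I "((((), 0), 0), 0)" e "d1 * d2 * d3" H])
    have "1 \<le> d1 * d2 * d3" using 1 2 3 by simp
    then have "1 \<le> real (d1 * d2 * d3)" by (simp del: of_nat_mult)
    then have "1 * 1 \<le> H" unfolding H_def by (intro mult_mono) auto
    then show "H \<ge> 1" by simp
    show "int_rep I e H (real (d1 * d2 * d3))"
      using rep[of 1 1 1 "d1 * d2 * d3"] int_rep_1[OF fin, of e] by simp
    show "int_rep I e H (real (d1 * d2 * d3) * \<alpha>)" by (rule rep[OF a, of "d2 * d3"]) (use 1 in auto)
    show "int_rep I e H (real (d1 * d2 * d3) * \<beta>)" by (rule rep[OF b, of "d1 * d3"]) (use 2 in auto)
    show "int_rep I e H (real (d1 * d2 * d3) * \<gamma>)" by (rule rep[OF c, of "d1 * d2"]) (use 3 in auto)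
  qed (use 1 2 3 fin in \<open>auto simp: I_def I2_def I1_def e_def e2_def e1_def\<close>)
qed

section \<open>The real Gelfond--Schneider theorem\<close>

text \<open>Each column is replaced by its error of interpolation from the preceding columns. Node
  differences are at most 2 X and the Cauchy radius is 4 X, so column j gains the factor (2 X / 4
  X)^j; the 5 X is X + 4 X.\<close>

lemma interpolation_det_bound:
  fixes x b :: "nat \<Rightarrow> real" and a :: "nat \<Rightarrow> nat"
  assumes inj: "inj_on x {..<n}" and X: "X \<ge> 1" "\<And>j. j < n \<Longrightarrow> \<bar>x j\<bar> \<le> X"
    and a: "\<And>i. i < n \<Longrightarrow> a i \<le> T" and b: "\<And>i. i < n \<Longrightarrow> \<bar>b i\<bar> \<le> W"
  shows "\<bar>Determinant.det (mat n n (\<lambda>(i, j). x j ^ a i * exp (b i * x j)))\<bar> \<le>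
           fact n * ((5 * X) ^ T * exp (W * (5 * X))) ^ n * (\<Prod>j<n. (1/2) ^ j)"
proof -
  define M where "M = (5 * X) ^ T * exp (W * (5 * X))"
  define A where "A = mat n n (\<lambda>(i, j). x j ^ a i * exp (b i * x j))"
  have M: "M \<ge> 0" using X by (simp add: M_def)
  have "\<forall>j\<in>{..<n}. \<exists>c. \<forall>F. (\<forall>n t. (F n has_real_derivative F (Suc n) t) (at t)) \<longrightarrow>
      (\<exists>\<xi>\<in>{-X..X}. F 0 (x j) - (\<Sum>k<j. c k * F 0 (x k)) = (\<Prod>k<j. x j - x k) * F j \<xi> / fact j)"
  proof
    fix j assume "j \<in> {..<n}"
    then have "inj_on x {..j}" "x ` {..j} \<subseteq> {-X..X}"
      using X(2) by (auto intro: inj_on_subset[OF inj] simp: abs_le_iff)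
         (smt (verit) X(2) abs_le_D2 order.strict_trans1)+
    then show "\<exists>c. \<forall>F. (\<forall>n t. (F n has_real_derivative F (Suc n) t) (at t)) \<longrightarrow>
      (\<exists>\<xi>\<in>{-X..X}. F 0 (x j) - (\<Sum>k<j. c k * F 0 (x k)) = (\<Prod>k<j. x j - x k) * F j \<xi> / fact j)"
      by (rule interpolation_error)
  qed
  from bchoice[OF this] obtain c where
    "\<forall>j\<in>{..<n}. \<forall>F. (\<forall>n t. (F n has_real_derivative F (Suc n) t) (at t)) \<longrightarrow>
      (\<exists>\<xi>\<in>{-X..X}. F 0 (x j) - (\<Sum>k<j. c j k * F 0 (x k)) = (\<Prod>k<j. x j - x k) * F j \<xi> / fact j)" ..
  then have c: "\<exists>\<xi>\<in>{-X..X}. F 0 (x j) - (\<Sum>k<j. c j k * F 0 (x k)) = (\<Prod>k<j. x j - x k) * F j \<xi> / fact j"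
    if "j < n" "\<forall>n t. (F n has_real_derivative F (Suc n) t) (at t)" for j F
    using that by blast
  \<comment> \<open>Unit upper triangular matrix of the column operations, so the determinant does
    not change.\<close>
  define C where "C = mat n n (\<lambda>(k, j). if k = j then 1 else if k < j then - c j k else 0)"
  have A: "A \<in> carrier_mat n n" and C: "C \<in> carrier_mat n n" by (simp_all add: A_def C_def)
  then have AC: "A * C \<in> carrier_mat n n" by simp
  have "Determinant.det C = 1"
    by (subst det_upper_triangular[OF _ C])
       (auto simp: C_def prod_list_diag_prod intro!: prod.neutral)
  then have det: "Determinant.det (A * C) = Determinant.det A"
    by (simp add: det_mult[OF A C])
  have entry: "\<bar>(A * C) $$ (i, j)\<bar> \<le> M * (1/2) ^ j" if ij: "i < n" "j < n" for i j
  proof -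
    obtain F where F: "F 0 = (\<lambda>x. x ^ a i * exp (b i * x))"
      "\<forall>n t. (F n has_real_derivative F (Suc n) t) (at t)"
      "\<And>n t. \<bar>t\<bar> \<le> X \<Longrightarrow>
        \<bar>F n t\<bar> \<le> fact n * ((X + 4 * X) ^ a i * exp (\<bar>b i\<bar> * (X + 4 * X))) / (4 * X) ^ n"
      using monomial_exp_derivatives[of X "4 * X" "a i" "b i"] X(1) by auto
    obtain \<xi> where \<xi>: "\<xi> \<in> {-X..X}"
      "F 0 (x j) - (\<Sum>k<j. c j k * F 0 (x k)) = (\<Prod>k<j. x j - x k) * F j \<xi> / fact j"
      using c[OF ij(2) F(2)] by auto
    have "(A * C) $$ (i, j) = (\<Sum>k = 0..<n. F 0 (x k) * (if k = j then 1 else if k < j then - c j k else 0))"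
      using ij by (simp add: A_def C_def scalar_prod_def F(1))
    also have "\<dots> = (\<Sum>k\<in>insert j {..<j}. F 0 (x k) * (if k = j then 1 else if k < j then - c j k else 0))"
      using ij by (intro sum.mono_neutral_right) auto
    also have "\<dots> = F 0 (x j) - (\<Sum>k<j. c j k * F 0 (x k))"
      by (simp add: sum_negf[symmetric] mult.commute)
    finally have eq: "(A * C) $$ (i, j) = (\<Prod>k<j. x j - x k) * F j \<xi> / fact j"
      using \<xi>(2) by simp
    have "\<bar>\<Prod>k<j. x j - x k\<bar> \<le> (\<Prod>k<j. 2 * X)"
      unfolding abs_prod
    proof (intro prod_mono conjI)
      fix k assume "k \<in> {..<j}"
      then show "\<bar>x j - x k\<bar> \<le> 2 * X" using X(2)[of j] X(2)[of k] ij by auto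
    qed auto
    then have 1: "\<bar>\<Prod>k<j. x j - x k\<bar> \<le> (2 * X) ^ j" by simp
    have "(5 * X) ^ a i * exp (\<bar>b i\<bar> * (5 * X)) \<le> M"
      unfolding M_def
    proof (rule mult_mono)
      show "(5 * X) ^ a i \<le> (5 * X) ^ T"
        using X(1) a[OF ij(1)] by (intro power_increasing) auto
      show "exp (\<bar>b i\<bar> * (5 * X)) \<le> exp (W * (5 * X))"
        using X(1) b[OF ij(1)] by simp
    qed (use X(1) in auto)
    then have "(X + 4 * X) ^ a i * exp (\<bar>b i\<bar> * (X + 4 * X)) \<le> M" by simp
    note bM = this
    have "\<bar>F j \<xi>\<bar> \<le> fact j * ((X + 4 * X) ^ a i * exp (\<bar>b i\<bar> * (X + 4 * X))) / (4 * X) ^ j"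
      by (rule F(3)) (use \<xi>(1) in auto)
    also have "\<dots> \<le> fact j * M / (4 * X) ^ j"
      using X(1) by (intro divide_right_mono mult_left_mono bM) auto
    finally have "\<bar>F j \<xi>\<bar> \<le> fact j * M / (4 * X) ^ j" .
    note Fb = this
    have "\<bar>(A * C) $$ (i, j)\<bar> = \<bar>\<Prod>k<j. x j - x k\<bar> * \<bar>F j \<xi>\<bar> / fact j"
      unfolding eq by (simp add: abs_mult)
    also have "\<dots> \<le> (2 * X) ^ j * (fact j * M / (4 * X) ^ j) / fact j"
      using X(1) by (intro divide_right_mono mult_mono 1 Fb) auto
    also have "\<dots> = M * (1/2) ^ j"
    proof -
      have "(4 * X) ^ j = (2 * X) ^ j * 2 ^ j" unfolding power_mult_distrib[symmetric] by simp
      moreover have "u * (f * M / (u * v)) / f = M * (1 / v)" if "u \<noteq> 0" "f \<noteq> 0" for u f v :: real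
        using that by simp
      moreover have "(2 * X) ^ j \<noteq> 0" "fact j \<noteq> (0 :: real)" using X(1) by auto
      ultimately show ?thesis unfolding power_one_over by metis
    qed
    finally show ?thesis .
  qed
  have "\<bar>Determinant.det (A * C)\<bar> \<le> (\<Sum>p | p permutes {0..<n}. M ^ n * (\<Prod>j<n. (1/2) ^ j))"
    unfolding det_def'[OF AC]
  proof (rule order.trans[OF sum_abs], rule sum_mono)
    fix p assume "p \<in> {p. p permutes {0..<n}}"
    then have p: "p permutes {0..<n}" by simp
    have "\<bar>signof p :: real\<bar> = 1" by (rule signof_cases[of p, where 'a = real]) auto
    then have "\<bar>signof p * (\<Prod>i = 0..<n. (A * C) $$ (i, p i))\<bar> = (\<Prod>i = 0..<n. \<bar>(A * C) $$ (i, p i)\<bar>)"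
      by (simp add: abs_mult abs_prod)
    also have "\<dots> \<le> (\<Prod>i = 0..<n. M * (1/2) ^ p i)"
      using permutes_in_image[OF p] by (intro prod_mono conjI entry) auto
    also have "\<dots> = M ^ n * (\<Prod>i = 0..<n. (1/2) ^ p i)" by (simp add: prod.distrib)
    \<comment> \<open>A permutation uses every column once, so all Leibniz terms share the same
      power of 1/2.\<close>
    also have "(\<Prod>i = 0..<n. (1/2::real) ^ p i) = (\<Prod>j = 0..<n. (1/2) ^ j)"
      using prod.permute[OF p, of "\<lambda>j. (1/2::real) ^ j"] by (simp add: o_def)
    finally show "\<bar>signof p * (\<Prod>i = 0..<n. (A * C) $$ (i, p i))\<bar> \<le> M ^ n * (\<Prod>j<n. (1/2) ^ j)"
      by (simp add: lessThan_atLeast0)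
  qed
  then have "\<bar>Determinant.det A\<bar> \<le> fact n * M ^ n * (\<Prod>j<n. (1/2) ^ j)"
    by (simp add: card_permutations det mult.assoc)
  then show ?thesis unfolding A_def M_def .
qed

text \<open>A linear dependence of the rows is an exponential polynomial with T' frequencies and
  degrees below T. It vanishes at T T' points, more than \<open>exponential_polynomial_zeros\<close>
  allows unless all coefficients are 0.\<close>

lemma interpolation_det_nonzero:
  fixes x :: "nat \<Rightarrow> real"
  assumes inj: "inj_on x {..<T * T'}" and w: "w \<noteq> 0"
  shows "Determinant.det (mat (T * T') (T * T')
           (\<lambda>(i, j). x j ^ (i mod T) * exp (real (i div T) * w * x j))) \<noteq> 0"
proof
  let ?n = "T * T'"
  define A where "A = mat ?n ?n (\<lambda>(i, j). x j ^ (i mod T) * exp (real (i div T) * w * x j))"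
  have A: "A \<in> carrier_mat ?n ?n" by (simp add: A_def)
  assume "Determinant.det (mat ?n ?n (\<lambda>(i, j). x j ^ (i mod T) * exp (real (i div T) * w * x j))) = 0"
  then have "Determinant.det (transpose_mat A) = 0" by (simp add: det_transpose[OF A] flip: A_def)
  then obtain v where v: "v \<in> carrier_vec ?n" "v \<noteq> 0\<^sub>v ?n" "transpose_mat A *\<^sub>v v = 0\<^sub>v ?n"
    using det_0_iff_vec_prod_zero[of "transpose_mat A" ?n] A by auto
  \<comment> \<open>Row i = s + T t stands for the function x^s exp (t w x), so \<open>p t\<close>
    collects one block of T coordinates.\<close>
  define p where "p t = (\<Sum>s<T. monom (vec_index v (s + T * t)) s)" for t
  have cp: "poly.coeff (p t) s = (if s < T then vec_index v (s + T * t) else 0)" for s t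
    by (simp add: p_def coeff_sum sum.delta)
  have cnt: "(if p t = 0 then 0 else Suc (Polynomial.degree (p t))) \<le> T" for t
  proof -
    have "Polynomial.degree (p t) < T" if "p t \<noteq> 0"
      using that cp[of t "Polynomial.degree (p t)"] by (metis leading_coeff_0_iff)
    then show ?thesis by auto
  qed
  have "\<forall>t\<in>{..<T'}. p t = 0"
  proof (rule exponential_polynomial_zeros[where w = "\<lambda>t. real t * w" and Z = "x ` {..<?n}"])
    show "inj_on (\<lambda>t. real t * w) {..<T'}" using w by (auto simp: inj_on_def)
    have "(\<Sum>t<T'. if p t = 0 then 0 else Suc (Polynomial.degree (p t))) \<le> (\<Sum>t<T'. T)"
      by (intro sum_mono cnt)
    then show "(\<Sum>t<T'. if p t = 0 then 0 else Suc (Polynomial.degree (p t))) \<le> card (x ` {..<?n})"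
      using inj by (simp add: card_image mult.commute)
    fix z assume "z \<in> x ` {..<?n}"
    then obtain j where j: "j < ?n" "z = x j" by auto
    have "0 = vec_index (transpose_mat A *\<^sub>v v) j" using v j by simp
    also have "\<dots> = (\<Sum>i = 0..<?n. z ^ (i mod T) * exp (real (i div T) * w * z) * vec_index v i)"
      using j v(1) by (simp add: A_def scalar_prod_def)
    also have "\<dots> = (\<Sum>t<T'. \<Sum>s<T. z ^ s * exp (real t * w * z) * vec_index v (s + T * t))"
    proof -
      define f where "f i = z ^ (i mod T) * exp (real (i div T) * w * z) * vec_index v i" for i
      have "(\<Sum>i = 0..<?n. f i) = (\<Sum>t<T'. sum f {t * T..<t * T + T})"
        by (subst sum.nat_group) (simp add: lessThan_atLeast0 mult.commute)
      also have "\<dots> = (\<Sum>t<T'. \<Sum>s<T. f (s + t * T))"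
        using sum.shift_bounds_nat_ivl[of f 0 _ T]
        by (simp only: lessThan_atLeast0 add_0 add.commute[of "_ * T" T])
      also have "\<dots> = (\<Sum>t<T'. \<Sum>s<T. z ^ s * exp (real t * w * z) * vec_index v (s + T * t))"
        by (intro sum.cong refl) (auto simp: f_def mult.commute[of T])
      finally show ?thesis by (simp add: f_def)
    qed
    also have "\<dots> = (\<Sum>t<T'. poly (p t) z * exp (real t * w * z))"
      unfolding p_def poly_sum poly_monom sum_distrib_right by (simp add: mult_ac)
    finally show "(\<Sum>t<T'. poly (p t) z * exp (real t * w * z)) = 0" by simp
  qed auto
  moreover have "vec_index v i = poly.coeff (p (i div T)) (i mod T)" if "i < ?n" for i
  proof -
    have "T > 0" using that by (cases T) auto
    then show ?thesis by (simp add: cp)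
  qed
  ultimately have "vec_index v i = 0" if "i < ?n" for i
    using that less_mult_imp_div_less[of i T' T] by (simp add: mult.commute)
  then have "v = 0\<^sub>v ?n" using v(1) by (intro eq_vecI) auto
  with v(2) show False by simp
qed

text \<open>
  With \<open>L = m^4\<close> functions \<open>x^k \<alpha>^(l x)\<close> (\<open>k < m^3\<close>, \<open>l < m\<close>) and points \<open>s + t \<beta>\<close> (\<open>s, t < m^2\<close>), the
  factor \<open>2^(-L(L-1)/2)\<close> is \<open>exp (- c m^8)\<close> while everything else is \<open>exp (O(m^7 log m))\<close>.
\<close>
lemma real_gelfond_schneider_bound:
  fixes \<alpha> \<beta> :: real
  assumes \<alpha>: "\<alpha> > 0" "\<alpha> \<noteq> 1" and alg: "algebraic \<alpha>" "algebraic \<beta>" "algebraic (\<alpha> powr \<beta>)"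
    and irr: "\<beta> \<notin> \<rat>"
  obtains N :: nat and H :: real where "H \<ge> 1"
    "\<And>m::nat. m > 0 \<Longrightarrow>
       1 \<le> fact N * (2 * (fact (m ^ 4) * ((2 * real m ^ 2) ^ (m ^ 3) * H ^ (3 * m ^ 3)) ^ (m ^ 4))) ^ N *
         (H ^ (3 * m ^ 3 * m ^ 4) *
           (fact (m ^ 4) *
             ((5 * ((1 + \<bar>\<beta>\<bar>) * real m ^ 2)) ^ (m ^ 3) *
               exp (real m * \<bar>ln \<alpha>\<bar> * (5 * ((1 + \<bar>\<beta>\<bar>) * real m ^ 2)))) ^ (m ^ 4) *
             (\<Prod>j<m ^ 4. (1/2) ^ j)))"
proof -
  define \<gamma> where "\<gamma> = \<alpha> powr \<beta>"
  define w where "w = ln \<alpha>"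
  have w: "w \<noteq> 0" using \<alpha> by (simp add: w_def)
  obtain I :: "(((unit \<times> nat) \<times> nat) \<times> nat) set" and e i0 d H0 where rep0:
    "finite I" "i0 \<in> I" "e i0 \<noteq> 0" "d > (0 :: nat)" "H0 \<ge> 1"
    "int_rep I e H0 d" "int_rep I e H0 (d * \<alpha>)" "int_rep I e H0 (d * \<beta>)" "int_rep I e H0 (d * \<gamma>)"
    by (rule int_rep_three_algebraics[OF alg, folded \<gamma>_def]) blast
  \<comment> \<open>\<open>H\<close> also dominates the denominator d, so that its power can be
    estimated by a power of \<open>H\<close> in the final bound.\<close>
  define H where "H = max H0 (real d)"
  have H: "H \<ge> 1" "real d \<le> H" using rep0 by (auto simp: H_def)
  have rep: "int_rep I e H d" "int_rep I e H (d * \<alpha>)" "int_rep I e H (d * \<beta>)" "int_rep I e H (d * \<gamma>)"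
    using rep0 by (auto simp: H_def intro: int_rep_mono)
  show ?thesis
  proof (rule that[of H "card I"])
    fix m :: nat assume m: "m > 0"
    define n where "n = m ^ 4"
    define T where "T = m ^ 3"
    define S where "S = m ^ 2"
    \<comment> \<open>The two base-S digits of j enumerate the points s + t \<beta> with s, t <
      S.\<close>
    define x where "x j = real (j mod S) + real (j div S) * \<beta>" for j
    define X where "X = (1 + \<bar>\<beta>\<bar>) * real m ^ 2"
    have n: "n = T * m" "n = S * S"
      by (simp_all add: n_def T_def S_def power_numeral_reduce)
    have S: "S > 0" using m by (simp add: S_def)
    have m2: "1 \<le> (real m)\<^sup>2" using m by (intro one_le_power) auto
    then have m2': "1 \<le> 2 * (real m)\<^sup>2" by linarith
    have X: "X \<ge> 1"
    proof -
      have "1 * 1 \<le> (1 + \<bar>\<beta>\<bar>) * real m ^ 2" using m by (intro mult_mono one_le_power) auto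
      then show ?thesis by (simp add: X_def)
    qed
    have js: "j mod S < S" "j div S < S" if "j < n" for j
      using that S less_mult_imp_div_less[of j S S] by (auto simp: n(2))
    have xX: "\<bar>x j\<bar> \<le> X" if "j < n" for j
    proof -
      have "\<bar>x j\<bar> \<le> real (j mod S) + real (j div S) * \<bar>\<beta>\<bar>"
        unfolding x_def by (rule order.trans[OF abs_triangle_ineq]) (simp add: abs_mult)
      also have "\<dots> \<le> real S + real S * \<bar>\<beta>\<bar>"
        using js[OF that] by (intro add_mono mult_right_mono) auto
      finally show ?thesis by (simp add: X_def S_def algebra_simps)
    qed
    \<comment> \<open>Irrationality of \<beta> enters here: two equal points would express \<beta>
      as a quotient of integers.\<close>
    have inj: "inj_on x {..<n}"
    proof (rule inj_onI, rule ccontr)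
      fix j k assume jk: "j \<in> {..<n}" "k \<in> {..<n}" "x j = x k" "j \<noteq> k"
      have eq: "real (j mod S) - real (k mod S) = (real (k div S) - real (j div S)) * \<beta>"
        using jk(3) by (simp add: x_def algebra_simps)
      show False
      proof (cases "k div S = j div S")
        case True
        then have "k mod S = j mod S" using eq by simp
        then show False using True jk(4) by (metis div_mult_mod_eq)
      next
        case False
        then have "\<beta> = (real (j mod S) - real (k mod S)) / (real (k div S) - real (j div S))"
          using eq by (simp add: field_simps)
        then show False using irr by (simp add: Rats_divide)
      qed
    qed
    define A where "A = mat n n (\<lambda>(i, j). x j ^ (i mod T) * exp (real (i div T) * w * x j))"
    have A: "A \<in> carrier_mat n n" by (simp add: A_def)
    have im: "i mod T \<le> T" "i div T < m" if "i < n" for i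
      using that less_mult_imp_div_less[of i m T] m by (auto simp: n(1) T_def mult.commute)
    have upper: "\<bar>Determinant.det A\<bar> \<le>
        fact n * ((5 * X) ^ T * exp ((real m * \<bar>w\<bar>) * (5 * X))) ^ n * (\<Prod>j<n. (1/2) ^ j)"
      unfolding A_def
    proof (rule interpolation_det_bound[OF inj X xX])
      fix i assume i: "i < n"
      show "i mod T \<le> T" using im[OF i] by simp
      show "\<bar>real (i div T) * w\<bar> \<le> real m * \<bar>w\<bar>"
        unfolding abs_mult using im[OF i] by (intro mult_right_mono) auto
    qed auto
    have "Determinant.det A \<noteq> 0"
      using interpolation_det_nonzero[of x T m w] inj w by (simp add: A_def n(1))
    \<comment> \<open>Common exponent of d for all entries: the exponents a, b s and b t of d x_j, d
      \<alpha> and d \<gamma> are each at most m^3.\<close>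
    define E where "E = 3 * m ^ 3"
    define B where "B = (2 * real m ^ 2) ^ T * H ^ E"
    have B: "B \<ge> 1"
    proof -
      have "1 * 1 \<le> B" unfolding B_def
        using H m2' by (intro mult_mono one_le_power) auto
      then show ?thesis by simp
    qed
    have entry: "int_rep I e B ((real d ^ E \<cdot>\<^sub>m A) $$ (i, j))" if ij: "i < n" "j < n" for i j
    proof -
      define s t b a where "s = j mod S" "t = j div S" "b = i div T" "a = i mod T"
      note stba = this
      have st: "s < S" "t < S" using js[OF ij(2)] by (auto simp: stba)
      have ab: "a \<le> T" "b < m" using im[OF ij(1)] by (auto simp: stba)
      have ex: "exp (real b * w * x j) = \<alpha> ^ (b * s) * \<gamma> ^ (b * t)"
      proof -
        have "\<alpha> = exp w" "\<gamma> = exp (\<beta> * w)" using \<alpha>(1) by (auto simp: w_def \<gamma>_def powr_def)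
        then have "\<alpha> ^ (b * s) = exp (real (b * s) * w)" "\<gamma> ^ (b * t) = exp (real (b * t) * (\<beta> * w))"
          by (simp_all only: exp_of_nat_mult)
        moreover have "real b * w * x j = real (b * s) * w + real (b * t) * (\<beta> * w)"
          by (simp add: x_def stba algebra_simps)
        ultimately show ?thesis by (simp only: exp_add)
      qed
      have "a + b * s + b * t \<le> E"
      proof -
        have "b * s \<le> m * S" "b * t \<le> m * S" using st ab by (auto intro!: mult_le_mono)
        then show ?thesis using ab by (simp add: E_def T_def S_def power_numeral_reduce)
      qed
      then obtain r where r: "E = a + b * s + b * t + r" using le_Suc_ex by blast
      have "int_rep I e (H ^ r * (real s * H + real t * H) ^ a * H ^ (b * s) * H ^ (b * t))
        (real d ^ r * (real s * real d + real t * (real d * \<beta>)) ^ a * (real d * \<alpha>) ^ (b * s) * (real d * \<gamma>) ^ (b * t))"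
        using rep0(1) rep H
        by (intro int_rep_mult int_rep_power int_rep_add int_rep_of_nat) auto
      also have "real d ^ r * (real s * real d + real t * (real d * \<beta>)) ^ a * (real d * \<alpha>) ^ (b * s) * (real d * \<gamma>) ^ (b * t)
          = (real d ^ E \<cdot>\<^sub>m A) $$ (i, j)"
      proof -
        have "real s * real d + real t * (real d * \<beta>) = real d * x j"
          by (simp add: x_def stba algebra_simps)
        moreover have "(real d ^ E \<cdot>\<^sub>m A) $$ (i, j) = real d ^ E * (x j ^ a * exp (real b * w * x j))"
          using ij by (simp add: A_def stba)
        ultimately show ?thesis unfolding ex by (simp only: r power_add power_mult_distrib mult_ac)
      qed
      finally have R: "int_rep I e (H ^ r * (real s * H + real t * H) ^ a * H ^ (b * s) * H ^ (b * t))
          ((real d ^ E \<cdot>\<^sub>m A) $$ (i, j))" .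
      have "H ^ r * (real s * H + real t * H) ^ a * H ^ (b * s) * H ^ (b * t) = (real s + real t) ^ a * H ^ E"
        unfolding distrib_right[symmetric] by (simp only: r power_add power_mult_distrib mult_ac)
      also have "\<dots> \<le> (2 * real m ^ 2) ^ a * H ^ E"
      proof (intro mult_right_mono power_mono)
        have "real s \<le> real S" "real t \<le> real S" using st by auto
        moreover have "real S = real m ^ 2" by (simp add: S_def)
        ultimately show "real s + real t \<le> 2 * real m ^ 2" by linarith
      qed (use H in auto)
      also have "\<dots> \<le> B" unfolding B_def
        using ab H m2' by (intro mult_right_mono power_increasing) auto
      finally show ?thesis using R by (rule int_rep_mono[rotated])
    qed
    have "int_rep I e (fact n * B ^ n) (Determinant.det (real d ^ E \<cdot>\<^sub>m A))"
      using B by (intro int_rep_det rep0(1) entry) (use A in auto)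
    then have R: "int_rep I e (fact n * B ^ n) (real d ^ (E * n) * Determinant.det A)"
      using A by (simp add: power_mult)
    have "1 * 1 \<le> (fact n :: real) * B ^ n"
      using B by (intro mult_mono one_le_power fact_ge_1) auto
    then have "1 \<le> fact (card I) * (2 * (fact n * B ^ n)) ^ card I * \<bar>real d ^ (E * n) * Determinant.det A\<bar>"
      using rep0 \<open>Determinant.det A \<noteq> 0\<close> by (intro int_rep_lower_bound[OF _ _ _ R]) auto
    also have "\<dots> = fact (card I) * (2 * (fact n * B ^ n)) ^ card I * (real d ^ (E * n) * \<bar>Determinant.det A\<bar>)"
      by (simp add: abs_mult)
    also have "\<dots> \<le> fact (card I) * (2 * (fact n * B ^ n)) ^ card I *
       (H ^ (E * n) * (fact n * ((5 * X) ^ T * exp ((real m * \<bar>w\<bar>) * (5 * X))) ^ n * (\<Prod>j<n. (1/2) ^ j)))"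
      using H B by (intro mult_left_mono mult_mono upper power_mono) auto
    finally show "1 \<le> fact (card I) * (2 * (fact (m ^ 4) * ((2 * real m ^ 2) ^ (m ^ 3) * H ^ (3 * m ^ 3)) ^ (m ^ 4))) ^ card I *
         (H ^ (3 * m ^ 3 * m ^ 4) *
           (fact (m ^ 4) *
             ((5 * ((1 + \<bar>\<beta>\<bar>) * real m ^ 2)) ^ (m ^ 3) *
               exp (real m * \<bar>ln \<alpha>\<bar> * (5 * ((1 + \<bar>\<beta>\<bar>) * real m ^ 2)))) ^ (m ^ 4) *
             (\<Prod>j<m ^ 4. (1/2) ^ j)))"
      unfolding n_def T_def X_def w_def B_def E_def .
  qed (use H in auto)
qed

section \<open>Comparison of the two bounds as m grows\<close>

lemma prod_half_powers: "(\<Prod>j<n. (1/2 :: real) ^ j) = exp (- (ln 2 * (real n * (real n - 1) / 2)))"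
proof (induction n)
  case (Suc n)
  have "exp (- ln 2) = (1/2 :: real)" by (simp add: exp_minus)
  then have half: "(1/2 :: real) ^ n = exp (real n * - ln 2)" by (simp only: exp_of_nat_mult)
  have "(\<Prod>j<Suc n. (1/2 :: real) ^ j) = exp (- (ln 2 * (real n * (real n - 1) / 2)) + real n * - ln 2)"
    by (simp only: prod.lessThan_Suc Suc.IH half exp_add)
  also have "- (ln 2 * (real n * (real n - 1) / 2)) + real n * - ln 2 =
      - (ln 2 * (real (Suc n) * (real (Suc n) - 1) / 2))"
    by (simp add: algebra_simps)
  finally show ?case .
qed simp

text \<open>After taking logarithms, all factors but the power of 2 contribute at most C m^7 (ln m +
  1), whereas the power of 2 contributes at most -(ln 2) m^8 / 4. This is contradictory for large
  m.\<close>

theorem real_gelfond_schneider: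
  fixes \<alpha> \<beta> :: real
  assumes \<alpha>: "\<alpha> > 0" "\<alpha> \<noteq> 1" and alg: "algebraic \<alpha>" "algebraic \<beta>" "algebraic (\<alpha> powr \<beta>)"
  shows "\<beta> \<in> \<rat>"
proof (rule ccontr)
  assume irr: "\<beta> \<notin> \<rat>"
  obtain N :: nat and H :: real where H: "H \<ge> 1" and bound: "\<And>m::nat. m > 0 \<Longrightarrow>
       1 \<le> fact N * (2 * (fact (m ^ 4) * ((2 * real m ^ 2) ^ (m ^ 3) * H ^ (3 * m ^ 3)) ^ (m ^ 4))) ^ N *
         (H ^ (3 * m ^ 3 * m ^ 4) *
           (fact (m ^ 4) *
             ((5 * ((1 + \<bar>\<beta>\<bar>) * real m ^ 2)) ^ (m ^ 3) *
               exp (real m * \<bar>ln \<alpha>\<bar> * (5 * ((1 + \<bar>\<beta>\<bar>) * real m ^ 2)))) ^ (m ^ 4) *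
             (\<Prod>j<m ^ 4. (1/2) ^ j)))"
    by (rule real_gelfond_schneider_bound[OF \<alpha> alg irr]) blast
  define b where "b = 1 + \<bar>\<beta>\<bar>"
  define w where "w = \<bar>ln \<alpha>\<bar>"
  define h where "h = ln H"
  have b: "b \<ge> 1" and w: "w \<ge> 0" and h: "h \<ge> 0" using H by (auto simp: b_def w_def h_def)
  \<comment> \<open>Sum of the coefficients of \<open>Q\<close> in the final estimate: first those
    of the lower bound, with exponent N, then those of the determinant.\<close>
  define C where "C = ln (fact N) + real N * (ln 2 + 4 + (2 + 3 * h)) + 3 * h + 4 + (ln (5 * b) + 2 + 5 * w * b)"
  have "eventually (\<lambda>m::nat. C * (ln (real m) + 1) < ln 2 / 4 * real m) at_top"
    by real_asymp
  then have "eventually (\<lambda>m::nat. m \<ge> 2 \<and> C * (ln (real m) + 1) < ln 2 / 4 * real m) at_top"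
    by (intro eventually_conj eventually_ge_at_top)
  then obtain m :: nat where m: "m \<ge> 2" "C * (ln (real m) + 1) < ln 2 / 4 * real m"
    by (auto simp: eventually_at_top_linorder)
  define L where "L = ln (real m) + 1"
  define M where "M = real m"
  have M: "M \<ge> 2" and L: "L \<ge> 1" using m by (auto simp: M_def L_def)
  have lf: "ln (fact (m ^ 4)) \<le> 4 * M ^ 4 * L"
  proof -
    have "ln (fact (m ^ 4)) \<le> ln (real ((m ^ 4) ^ (m ^ 4)))"
      using fact_le_power[of "m ^ 4", where 'a = real] m by (subst ln_le_cancel_iff) auto
    also have "\<dots> = 4 * M ^ 4 * ln M" using m by (simp add: ln_realpow M_def)
    also have "\<dots> \<le> 4 * M ^ 4 * L" using M by (intro mult_left_mono) (auto simp: L_def M_def)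
    finally show ?thesis .
  qed
  have lpm: "ln (x ^ k * y) = real k * ln x + ln y" if "x > 0" "y > 0" for x y :: real and k
    using that by (simp add: ln_mult ln_realpow)
  have hk: "ln (H ^ k) = real k * h" for k
    using H by (simp add: ln_realpow h_def)
  have lB: "ln ((2 * M ^ 2) ^ (m ^ 3) * H ^ (3 * m ^ 3)) \<le> M ^ 3 * L * (2 + 3 * h)"
  proof -
    have "ln ((2 * M ^ 2) ^ (m ^ 3) * H ^ (3 * m ^ 3)) = M ^ 3 * (ln 2 + 2 * ln M + 3 * h)"
    proof -
      have "ln ((2 * M ^ 2) ^ (m ^ 3) * H ^ (3 * m ^ 3)) = real (m ^ 3) * ln (2 * M ^ 2) + real (3 * m ^ 3) * h"
        unfolding hk[symmetric] using M H by (intro lpm) auto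
      also have "ln (2 * M ^ 2) = ln 2 + 2 * ln M"
        using M by (subst ln_mult) (simp_all add: ln_realpow)
      finally show ?thesis by (simp add: M_def algebra_simps)
    qed
    also have "\<dots> \<le> M ^ 3 * (2 * L + 3 * h * L)"
    proof (intro mult_left_mono add_mono)
      show "ln 2 + 2 * ln M \<le> 2 * L" using ln_2_less_1 by (simp add: L_def M_def)
      show "3 * h \<le> 3 * h * L" using mult_left_mono[OF L, of "3 * h"] h by simp
    qed (use M in auto)
    finally show ?thesis by (simp add: algebra_simps)
  qed
  have lM: "ln ((5 * (b * M ^ 2)) ^ (m ^ 3) * exp (M * w * (5 * (b * M ^ 2)))) \<le> M ^ 3 * L * (ln (5 * b) + 2 + 5 * w * b)"
  proof -
    have "ln ((5 * (b * M ^ 2)) ^ (m ^ 3) * exp (M * w * (5 * (b * M ^ 2)))) =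
        M ^ 3 * ln (5 * b * M ^ 2) + M * w * (5 * (b * M ^ 2))"
      using M b lpm[of "5 * (b * M ^ 2)" "exp (M * w * (5 * (b * M ^ 2)))" "m ^ 3"]
      by (simp only: mult.assoc ln_exp) (simp add: M_def)
    also have "ln (5 * b * M ^ 2) = ln (5 * b) + 2 * ln M"
      using M b by (subst ln_mult) (auto simp: ln_realpow)
    also have "M ^ 3 * (ln (5 * b) + 2 * ln M) + M * w * (5 * (b * M ^ 2)) =
        M ^ 3 * (ln (5 * b) + 2 * ln M + 5 * w * b)"
      by (simp add: algebra_simps power_numeral_reduce)
    also have "\<dots> \<le> M ^ 3 * (ln (5 * b) * L + 2 * L + 5 * w * b * L)"
    proof (intro mult_left_mono add_mono)
      show "ln M \<le> L" by (simp add: L_def M_def)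
      show "ln (5 * b) \<le> ln (5 * b) * L" using mult_left_mono[OF L, of "ln (5 * b)"] b by simp
      show "5 * w * b \<le> 5 * w * b * L" using mult_left_mono[OF L, of "5 * w * b"] w b by simp
    qed (use M in auto)
    finally show ?thesis by (simp add: algebra_simps)
  qed
  have expand: "ln (F0 * (2 * (F * B ^ k)) ^ N * (H ^ l * (F * G ^ k * P))) =
      ln F0 + real N * (ln 2 + (ln F + real k * ln B)) + (real l * h + (ln F + real k * ln G + ln P))"
    if "F0 > 0" "F > 0" "B > 0" "G > 0" "P > 0" for F0 F B G P :: real and k l
    using that H by (simp add: ln_mult ln_realpow h_def distrib_left)
  \<comment> \<open>Common majorant of all terms other than the power of 2.\<close>
  define Q where "Q = M ^ 7 * L"
  have Q1: "Q \<ge> 1" using mult_mono[of 1 "M ^ 7" 1 L] M L by (auto simp: Q_def)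
  have Q4: "M ^ 4 * L \<le> Q" unfolding Q_def using M L by (intro mult_right_mono power_increasing) auto
  have Q7: "M ^ 7 \<le> Q" using mult_left_mono[OF L, of "M ^ 7"] M by (simp add: Q_def)
  define lnB where "lnB = ln ((2 * M ^ 2) ^ (m ^ 3) * H ^ (3 * m ^ 3))"
  define lnG where "lnG = ln ((5 * (b * M ^ 2)) ^ (m ^ 3) * exp (M * w * (5 * (b * M ^ 2))))"
  define lnF where "lnF = ln (fact (m ^ 4) :: real)"
  have "0 \<le> ln (fact N * (2 * (fact (m ^ 4) * ((2 * M ^ 2) ^ (m ^ 3) * H ^ (3 * m ^ 3)) ^ (m ^ 4))) ^ N *
         (H ^ (3 * m ^ 3 * m ^ 4) *
           (fact (m ^ 4) * ((5 * (b * M ^ 2)) ^ (m ^ 3) * exp (M * w * (5 * (b * M ^ 2)))) ^ (m ^ 4) *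
             (\<Prod>j<m ^ 4. (1/2) ^ j))))"
    using bound[of m] m unfolding b_def w_def M_def by (intro ln_ge_zero) simp
  also have "\<dots> = ln (fact N) + real N * (ln 2 + (lnF + real (m ^ 4) * lnB)) +
      (real (3 * m ^ 3 * m ^ 4) * h + (lnF + real (m ^ 4) * lnG + ln (\<Prod>j<m ^ 4. (1/2) ^ j)))"
    unfolding lnB_def lnG_def lnF_def using M H b by (intro expand) (auto intro!: mult_pos_pos prod_pos)
  also have "ln (\<Prod>j<m ^ 4. (1/2 :: real) ^ j) = - (ln 2 * (M ^ 4 * (M ^ 4 - 1) / 2))"
    unfolding prod_half_powers by (simp add: M_def)
  finally have nonneg: "0 \<le> ln (fact N) + real N * (ln 2 + (lnF + real (m ^ 4) * lnB)) +
      (real (3 * m ^ 3 * m ^ 4) * h + (lnF + real (m ^ 4) * lnG + - (ln 2 * (M ^ 4 * (M ^ 4 - 1) / 2))))" .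
  have "real (m ^ 4) = M ^ 4" "real (3 * m ^ 3 * m ^ 4) = 3 * M ^ 7"
    by (simp_all add: M_def flip: power_add)
  from nonneg[unfolded this] have "ln 2 * (M ^ 4 * (M ^ 4 - 1) / 2) \<le> ln (fact N) + real N * (ln 2 + (lnF + M ^ 4 * lnB)) +
      (3 * M ^ 7 * h + (lnF + M ^ 4 * lnG))"
    by linarith
  also have "\<dots> \<le> ln (fact N) * Q + real N * (ln 2 * Q + (4 * Q + (2 + 3 * h) * Q)) +
      (3 * h * Q + (4 * Q + (ln (5 * b) + 2 + 5 * w * b) * Q))"
  proof (intro add_mono mult_left_mono)
    show "ln (fact N) \<le> ln (fact N) * Q"
      using mult_left_mono[OF Q1, of "ln (fact N)"] fact_ge_1[of N, where 'a = real] by simp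
    show "ln 2 \<le> ln 2 * Q" using mult_left_mono[OF Q1, of "ln 2"] by simp
    show "lnF \<le> 4 * Q" "lnF \<le> 4 * Q" using lf Q4 by (auto simp: lnF_def)
    have e: "M ^ 4 * (M ^ 3 * L * c) = c * Q" for c by (simp add: Q_def flip: power_add)
    show "M ^ 4 * lnB \<le> (2 + 3 * h) * Q"
      unfolding lnB_def e[symmetric] using M by (intro mult_left_mono lB) auto
    show "M ^ 4 * lnG \<le> (ln (5 * b) + 2 + 5 * w * b) * Q"
      unfolding lnG_def e[symmetric] using M by (intro mult_left_mono lM) auto
    show "3 * M ^ 7 * h \<le> 3 * h * Q" using mult_left_mono[OF Q7, of "3 * h"] h by (simp add: mult_ac)
  qed auto
  also have "\<dots> = M ^ 7 * (C * L)" by (simp add: C_def Q_def algebra_simps)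
  also have "\<dots> < M ^ 7 * (ln 2 / 4 * M)"
    using m(2) M by (intro mult_strict_left_mono) (auto simp: L_def M_def)
  also have "\<dots> = ln 2 * (M ^ 4 * M ^ 4 / 4)" by (simp flip: power_add power_Suc2)
  finally have "M ^ 4 * (M ^ 4 - 1) / 2 < M ^ 4 * M ^ 4 / 4" by simp
  \<comment> \<open>Since M^4 \<ge> 2, M^4 (M^4 - 1) / 2 is at least M^8 / 4.\<close>
  moreover have "M ^ 4 * 2 \<le> M ^ 4 * M ^ 4"
    using power_mono[OF M, of 4] by (intro mult_left_mono) auto
  ultimately show False by (simp add: algebra_simps)
qed

section \<open>Two-cycles and the limits of towers\<close>

lemma powr_antimono:
  fixes x :: real
  assumes "0 < x" "x \<le> 1" "s \<le> t"
  shows "x powr t \<le> x powr s"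
  using assms by (auto simp: powr_def intro!: mult_right_mono_neg)

lemma powr_strict_antimono:
  fixes x :: real
  assumes "0 < x" "x < 1" "s < t"
  shows "x powr t < x powr s"
  using assms by (auto simp: powr_def intro!: mult_strict_right_mono_neg)

lemma powr_between:
  fixes x :: real
  assumes "0 < x" "x < 1" "t > 0"
  shows "0 < x powr t" "x powr t < 1"
  using assms powr_strict_antimono[of x 0 t] by auto

definition two_cycle :: "real \<Rightarrow> real \<Rightarrow> real \<Rightarrow> bool" where
  "two_cycle x a b \<longleftrightarrow> x powr b = a \<and> x powr a = b"

lemma two_cycle_range:
  assumes "0 < x" "x < 1" "two_cycle x a b"
  shows "0 < a" "a < 1" "0 < b" "b < 1"
proof -
  show "0 < a" "0 < b" using assms unfolding two_cycle_def by (metis powr_gt_zero less_numeral_extra(3))+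
  then show "a < 1" "b < 1"
    using powr_between(2)[OF assms(1,2)] assms(3) unfolding two_cycle_def by metis+
qed

text \<open>The map t -> x^t is decreasing, and the induction starts from x = x^1 \<le> x^b = a. As
  \<open>tower x 0\<close> is x, even indices are odd heights.\<close>

lemma tower_le_two_cycle:
  assumes x: "0 < x" "x < 1" and c: "two_cycle x a b"
  shows "tower x (2 * n) \<le> a \<and> b \<le> tower x (2 * n + 1)"
proof -
  have ab: "x powr b = a" "x powr a = b" using c by (auto simp: two_cycle_def)
  have odd: "b \<le> tower x (2 * n + 1)" if "tower x (2 * n) \<le> a" for n
    using powr_antimono[of x "tower x (2 * n)" a] that x by (simp add: ab)
  have "tower x (2 * n) \<le> a"
  proof (induction n)
    case 0
    have "x powr 1 \<le> x powr b" using x two_cycle_range[OF x c] by (intro powr_antimono) auto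
    then show ?case using x by (simp add: ab)
  next
    case (Suc n)
    have "x powr tower x (2 * n + 1) \<le> x powr b" using x odd[OF Suc] by (intro powr_antimono) auto
    then show ?case by (simp add: ab)
  qed
  with odd show ?thesis by blast
qed

text \<open>The second iterate of t -> x^t is increasing, so the towers of odd height increase and
  are bounded by 1. Continuity of the map supplies the other limit and the cycle equations.\<close>

lemma tower_limits:
  assumes x: "0 < x" "x < 1"
  obtains u v where "(\<lambda>n. tower x (2 * n)) \<longlonglongrightarrow> u" "(\<lambda>n. tower x (2 * n + 1)) \<longlonglongrightarrow> v" "two_cycle x u v"
proof -
  have pos: "tower x n > 0" for n using x by (cases n) auto
  have le1: "tower x n \<le> 1" for n
    using x pos powr_between(2)[OF x] by (cases n) (auto intro: less_imp_le)
  have step: "tower x (2 * n) \<le> tower x (2 * Suc n)" for n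
  proof (induction n)
    case 0
    have "x powr 1 \<le> x powr tower x 1" using x le1[of 1] by (intro powr_antimono) auto
    then show ?case using x by (simp add: numeral_2_eq_2)
  next
    case (Suc n)
    have "x powr (x powr tower x (2 * n)) \<le> x powr (x powr tower x (2 * Suc n))"
      using Suc x by (intro powr_antimono) auto
    then show ?case by simp
  qed
  have "incseq (\<lambda>n. tower x (2 * n))" by (rule incseq_SucI) (rule step)
  then obtain u where u: "(\<lambda>n. tower x (2 * n)) \<longlonglongrightarrow> u"
    by (rule incseq_convergent[of _ 1]) (auto simp: le1)
  have "(\<lambda>n. x powr tower x (2 * n)) \<longlonglongrightarrow> x powr u"
    using x by (intro tendsto_powr tendsto_const u) auto
  then have v: "(\<lambda>n. tower x (2 * n + 1)) \<longlonglongrightarrow> x powr u" by simp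
  have "(\<lambda>n. x powr tower x (2 * n + 1)) \<longlonglongrightarrow> x powr (x powr u)"
    using x by (intro tendsto_powr tendsto_const v) auto
  then have "(\<lambda>n. tower x (2 * Suc n)) \<longlonglongrightarrow> x powr (x powr u)" by simp
  moreover have "(\<lambda>n. tower x (2 * Suc n)) \<longlonglongrightarrow> u" by (rule LIMSEQ_Suc[OF u])
  ultimately have "x powr (x powr u) = u" by (rule LIMSEQ_unique)
  then show ?thesis using u v by (intro that[of u "x powr u"]) (auto simp: two_cycle_def)
qed

text \<open>The limits enclose every 2-cycle, so any proper 2-cycle proves that they differ.\<close>

lemma
  assumes x: "0 < x" "x < 1"
  shows two_cycle_h: "two_cycle x (h_o x) (h_e x)"
    and h_extremal: "two_cycle x a b \<Longrightarrow> h_o x \<le> a \<and> b \<le> h_e x"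
proof -
  obtain u v where uv: "(\<lambda>n. tower x (2 * n)) \<longlonglongrightarrow> u" "(\<lambda>n. tower x (2 * n + 1)) \<longlonglongrightarrow> v" "two_cycle x u v"
    using tower_limits[OF x] by blast
  have h: "h_o x = u" "h_e x = v" unfolding h_o_def h_e_def using uv by (auto intro: limI)
  show "two_cycle x (h_o x) (h_e x)" using uv h by simp
  assume "two_cycle x a b"
  from tower_le_two_cycle[OF x this] show "h_o x \<le> a \<and> b \<le> h_e x"
    unfolding h using LIMSEQ_le_const2[OF uv(1)] LIMSEQ_le_const[OF uv(2)] by blast
qed

text \<open>At the fixed point c the second iterate has derivative (ln c)^2, which exceeds 1 for x <
  exp (- exp 1). Hence \<open>G\<close> is negative just to the left of c but positive at 0, and a
  zero a < c of \<open>G\<close> starts a proper 2-cycle.\<close>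

lemma h_o_less_h_e:
  assumes x: "0 < x" "x < exp (- exp 1)"
  shows "h_o x < h_e x"
proof -
  have x1: "x < 1" using x(2) by (rule less_le_trans) simp
  define l where "l = ln x"
  have px: "x powr t = exp (t * l)" for t using x by (simp add: powr_def l_def)
  have "ln x < ln (exp (- exp 1))" using x by (subst ln_less_cancel_iff) auto
  then have l: "l < - exp 1" by (simp add: l_def)
  then have l0: "l \<le> 0" using exp_gt_zero[of "1 :: real"] by linarith
  have "\<exists>c\<ge>0. c \<le> 1 \<and> c - exp (c * l) = 0"
    using x1 x by (intro IVT') (auto intro!: continuous_intros simp: l_def)
  then obtain c where c: "0 \<le> c" "c = exp (c * l)" by auto
  then have c0: "c > 0" by (metis exp_gt_zero)
  have lc: "ln c = c * l" using c by (metis ln_exp)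
  \<comment> \<open>If c \<ge> 1/e, then ln c = c l \<le> l/e < -1 all the same.\<close>
  have "ln c < -1"
  proof (rule ccontr)
    assume "\<not> ln c < -1"
    then have "c \<ge> exp (-1)" using c0 by (simp add: not_less ln_ge_iff)
    then have "c * l \<le> exp (-1) * l" by (intro mult_right_mono_neg l0)
    also have "\<dots> < exp (-1) * (- exp 1)" using l by (intro mult_strict_left_mono) auto
    also have "\<dots> = -1" by (simp flip: exp_add)
    finally show False using \<open>\<not> ln c < -1\<close> lc by simp
  qed
  define G where "G t = exp (exp (t * l) * l) - t" for t
  have D: "DERIV G c :> exp (exp (c * l) * l) * (exp (c * l) * l * l) - 1"
    unfolding G_def by (auto intro!: derivative_eq_intros)
  have "exp (exp (c * l) * l) * (exp (c * l) * l * l) - 1 = ln c * ln c - 1"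
    by (simp add: lc flip: c(2))
  moreover have "ln c * ln c - 1 > 0"
    using \<open>ln c < -1\<close> mult_strict_mono[of 1 "- ln c" 1 "- ln c"] by simp
  ultimately obtain d where d: "d > 0" "\<And>h. h > 0 \<Longrightarrow> h < d \<Longrightarrow> G (c - h) < G c"
    using DERIV_pos_inc_left[OF D] by auto
  define h where "h = min d c / 2"
  have h: "0 < h" "h < d" "h < c" using d c0 by (auto simp: h_def)
  have "G c = 0" by (simp add: G_def flip: c(2))
  then have "G (c - h) < 0" using d(2)[OF h(1,2)] by simp
  moreover have "G 0 > 0" by (simp add: G_def)
  ultimately have "\<exists>a\<ge>0. a \<le> c - h \<and> G a = 0"
    using h by (intro IVT2') (auto intro!: continuous_intros simp: G_def)
  then obtain a where a: "a \<le> c - h" "G a = 0" by auto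
  have "two_cycle x a (x powr a)" using a(2) by (simp add: two_cycle_def px G_def)
  from h_extremal[OF x(1) x1 this] have "h_o x \<le> a" "x powr a \<le> h_e x" by auto
  moreover have "a < c" using a h by simp
  moreover have "x powr c < x powr a" using \<open>a < c\<close> x x1 by (intro powr_strict_antimono) auto
  moreover have "x powr c = c" using c(2) by (simp add: px)
  ultimately show ?thesis by linarith
qed

section \<open>The ratio b / a as a monotone parameter of proper 2-cycles\<close>

text \<open>The value of \<open>ln (- ln x)\<close> when \<open>x\<close> has a 2-cycle \<open>(a, b)\<close> with \<open>b / a = r\<close>.\<close>
definition cycle_param :: "real \<Rightarrow> real" where
  "cycle_param r = ln (ln r) - ln (r - 1) + r * ln r / (r - 1)"

text \<open>With r = s^2 and square roots taken, this is 2 s ln s < s^2 - 1. The difference of the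
  two sides vanishes at s = 1 and has derivative 2 (s - 1 - ln s) > 0.\<close>

lemma ln_square_bound:
  assumes "r > (1 :: real)"
  shows "r * (ln r)\<^sup>2 < (r - 1)\<^sup>2"
proof -
  define s where "s = sqrt r"
  have s: "s > 1" "r = s\<^sup>2" using assms by (auto simp: s_def)
  have "(\<lambda>t. t\<^sup>2 - 1 - 2 * t * ln t) 1 < (\<lambda>t. t\<^sup>2 - 1 - 2 * t * ln t) s"
  proof (rule DERIV_pos_imp_increasing_open[OF s(1)])
    fix t :: real assume t: "1 < t" "t < s"
    have "((\<lambda>t. t\<^sup>2 - 1 - 2 * t * ln t) has_real_derivative 2 * t - 2 * ln t - 2) (at t)"
      using t by (auto intro!: derivative_eq_intros simp: field_simps)
    moreover have "ln t < t - 1" using t ln_eq_minus_one[of t] ln_le_minus_one[of t] by fastforce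
    ultimately show "\<exists>y. ((\<lambda>t. t\<^sup>2 - 1 - 2 * t * ln t) has_real_derivative y) (at t) \<and> 0 < y"
      by (intro exI[of _ "2 * t - 2 * ln t - 2"]) auto
  qed (auto intro!: continuous_intros)
  then have "2 * s * ln s < r - 1" by (simp add: s)
  moreover have "2 * s * ln s \<ge> 0" using s by simp
  ultimately have "(2 * s * ln s)\<^sup>2 < (r - 1)\<^sup>2" by (intro power_strict_mono) auto
  moreover have "(2 * s * ln s)\<^sup>2 = r * (ln r)\<^sup>2"
    using s by (simp add: ln_realpow power_mult_distrib)
  ultimately show ?thesis by simp
qed

text \<open>Over a common denominator the derivative has numerator (t - 1)^2 - t (ln t)^2.\<close>

lemma cycle_param_strict_mono:
  assumes "1 < r" "r < s"
  shows "cycle_param r < cycle_param s"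
proof (rule DERIV_pos_imp_increasing[OF assms(2)])
  fix t assume "r \<le> t" "t \<le> s"
  then have t: "t > 1" using assms by simp
  then have lt: "ln t > 0" by simp
  have D: "(cycle_param has_real_derivative
      1 / t / ln t - 1 / (t - 1) + ((ln t + 1) * (t - 1) - t * ln t) / (t - 1)\<^sup>2) (at t)"
  proof -
    have 1: "((\<lambda>r. ln (ln r)) has_real_derivative 1 / t / ln t) (at t)"
      using t lt by (auto intro!: derivative_eq_intros)
    have 2: "((\<lambda>r. ln (r - 1)) has_real_derivative 1 / (t - 1)) (at t)"
      using t by (auto intro!: derivative_eq_intros)
    have 3: "((\<lambda>r. r * ln r) has_real_derivative ln t + 1) (at t)"
      using t by (auto intro!: derivative_eq_intros)
    have 4: "((\<lambda>r. r - 1) has_real_derivative 1) (at t)"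
      by (auto intro!: derivative_eq_intros)
    show ?thesis
      using DERIV_add[OF DERIV_diff[OF 1 2] DERIV_divide[OF 3 4]] t
      by (simp add: cycle_param_def[abs_def] power2_eq_square)
  qed
  have "1 / t / ln t - 1 / (t - 1) + ((ln t + 1) * (t - 1) - t * ln t) / (t - 1)\<^sup>2 =
      ((t - 1)\<^sup>2 - t * (ln t)\<^sup>2) / (t * ln t * (t - 1)\<^sup>2)"
    using t lt by (simp add: divide_simps) (simp add: algebra_simps power2_eq_square)
  also have "\<dots> > 0" using ln_square_bound[OF t] t lt by (intro divide_pos_pos) auto
  finally show "\<exists>y. (cycle_param has_real_derivative y) (at t) \<and> 0 < y" using D by blast
qed

text \<open>The limit at 1 from the right is 1, the value of ln (- ln x) at x = exp (- exp 1).
  Comparing with the intermediate \<open>r'\<close> first makes the inequality strict.\<close>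

lemma cycle_param_gt_1:
  assumes "r > 1"
  shows "cycle_param r > 1"
proof -
  define r' where "r' = (1 + r) / 2"
  have r': "1 < r'" "r' < r" using assms by (auto simp: r'_def)
  have "(cycle_param \<longlongrightarrow> 1) (at_right 1)"
    unfolding cycle_param_def[abs_def] by real_asymp
  moreover have "eventually (\<lambda>s. cycle_param s \<le> cycle_param r') (at_right 1)"
    using eventually_at_right_real[OF r'(1)]
    by eventually_elim (auto intro!: less_imp_le cycle_param_strict_mono)
  ultimately have "1 \<le> cycle_param r'" by (rule tendsto_upperbound) auto
  with cycle_param_strict_mono[OF r'] show ?thesis by simp
qed

text \<open>Logarithms of the cycle equations, with b = r a eliminated. The formula for ln b serves
  the rational case, the other two the uniqueness of the cycle.\<close>

lemma two_cycle_logs: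
  assumes x: "0 < x" "x < 1" and c: "two_cycle x a b" and ab: "a < b"
  defines "r \<equiv> b / a"
  shows "r > 1" "ln r = (r - 1) * a * - ln x" "(r - 1) * ln b = - ln r"
    and "ln (- ln x) = cycle_param r"
proof -
  note ran = two_cycle_range[OF x c]
  have la: "ln a = b * ln x" and lb: "ln b = a * ln x"
    using c x unfolding two_cycle_def by (metis ln_powr less_irrefl)+
  have b: "b = r * a" using ran by (simp add: r_def)
  show r: "r > 1" using ran ab by (simp add: r_def)
  have "ln r = ln b - ln a" using ran by (simp add: r_def ln_div)
  also have "\<dots> = a * ln x - b * ln x" by (simp only: la lb)
  also have "\<dots> = (r - 1) * a * - ln x" by (simp add: b algebra_simps)
  finally show lr: "ln r = (r - 1) * a * - ln x" .
  then show "(r - 1) * ln b = - ln r" by (simp add: lb)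
  have lx: "- ln x > 0" using x by simp
  have "ln (ln r) = ln (r - 1) + ln a + ln (- ln x)"
    unfolding lr using r ran lx by (simp only: ln_mult_pos mult_pos_pos diff_gt_0_iff_gt)
  moreover have "ln a = - (r * ln r / (r - 1))"
    using r by (simp add: la b lr field_simps)
  ultimately show "ln (- ln x) = cycle_param r" by (simp add: cycle_param_def)
qed

text \<open>Monotonicity of \<open>cycle_param\<close> recovers b / a from x; then ln r = (r - 1) a
  (- ln x) recovers a.\<close>

lemma two_cycle_unique:
  assumes x: "0 < x" "x < 1" and "two_cycle x a b" "a < b" "two_cycle x a' b'" "a' < b'"
  shows "a = a'" "b = b'"
proof -
  note 1 = two_cycle_logs[OF x assms(3,4)] and 2 = two_cycle_logs[OF x assms(5,6)]
  have r: "b / a = b' / a'"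
    using cycle_param_strict_mono[of "b / a" "b' / a'"] cycle_param_strict_mono[of "b' / a'" "b / a"] 1 2
    by fastforce
  define k where "k = (b / a - 1) * - ln x"
  have "k > 0" unfolding k_def using 1(1) x by (intro mult_pos_pos) auto
  moreover have "ln (b / a) = k * a" "ln (b / a) = k * a'"
    using 1(2) 2(2) unfolding k_def r by (simp_all only: mult_ac)
  ultimately show "a = a'" by simp
  then show "b = b'" using assms(3,5) unfolding two_cycle_def by metis
qed

lemma two_cycle_imp_less:
  assumes x: "0 < x" "x < 1" and "two_cycle x a b" "a < b"
  shows "x < exp (- exp 1)"
proof -
  have "1 < ln (- ln x)"
    using two_cycle_logs(1,4)[OF assms] cycle_param_gt_1 by simp
  then have "exp 1 < exp (ln (- ln x))" by simp
  then have "exp 1 < - ln x" using x by simp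
  then have "ln x < - exp 1" by simp
  then show ?thesis using x by (metis exp_less_cancel_iff exp_ln)
qed

lemma h_eqI:
  assumes "0 < x" "x < 1" "two_cycle x a b" "a < b"
  shows "h_o x = a" "h_e x = b"
proof -
  have "h_o x < h_e x" using h_extremal[OF assms(1-3)] assms(4) by linarith
  then show "h_o x = a" "h_e x = b"
    using two_cycle_unique[OF assms(1,2) two_cycle_h[OF assms(1,2)] _ assms(3,4)] by auto
qed

section \<open>Rational two-cycles\<close>

text \<open>By Bezout the power is a quotient of powers of the two given rationals.\<close>

lemma Rats_power_gcd:
  fixes y :: real
  assumes "y > 0" "m > 0" "y ^ m \<in> \<rat>" "y ^ n \<in> \<rat>"
  shows "y ^ gcd m n \<in> \<rat>"
proof -
  obtain p q where "m * p = n * q + gcd m n" using bezout_nat[of m n] assms(2) by auto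
  then have "(y ^ m) ^ p = (y ^ n) ^ q * y ^ gcd m n" by (simp flip: power_mult power_add)
  then have "y ^ gcd m n = (y ^ m) ^ p / (y ^ n) ^ q" using assms(1) by simp
  then show ?thesis using assms by simp
qed

text \<open>With p = k + 2, distinct positive p-th powers are more than p apart; this rules out the
  small gap c \<le> p in \<open>ratio_perfect_power\<close>.\<close>

lemma perfect_power_gap:
  fixes s :: nat
  assumes "s \<ge> 1"
  shows "s ^ (k + 2) + (k + 3) \<le> (s + 1) ^ (k + 2)"
proof (induction k)
  case 0
  then show ?case using assms by (simp add: power2_eq_square)
next
  case (Suc k)
  have "s ^ (Suc k + 2) + (Suc k + 3) \<le> (s + 1) * (s ^ (k + 2) + (k + 3))"
    using assms one_le_power[OF assms, of "k + 2"] by (simp add: algebra_simps)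
  also have "\<dots> \<le> (s + 1) * (s + 1) ^ (k + 2)" by (intro mult_left_mono Suc) auto
  finally show ?case by simp
qed

text \<open>If y = s/t in lowest terms, then s^p / t^p = q / (q + c) with both fractions reduced, so
  q and q + c are p-th powers at distance c \<le> p, impossible for p \<ge> 2. The condition c \<le>
  p covers both uses: p = c, and c = 1.\<close>

lemma ratio_perfect_power:
  fixes y :: real and q c p :: nat
  assumes "y \<in> \<rat>" "y > 0" "y ^ p = real q / real (q + c)" "coprime q c" "q \<ge> 1" "c \<ge> 1" "c \<le> p"
  shows "p = 1"
proof -
  obtain s t :: nat where st: "t \<noteq> 0" "\<bar>y\<bar> = real s / real t" "coprime s t"
    using Rats_abs_nat_div_natE[OF assms(1)] by metis
  then have y: "y = real s / real t" using assms(2) by simp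
  then have s: "s \<ge> 1" using assms(2) by (cases s) auto
  have "real s ^ p / real t ^ p = real q / real (q + c)" using assms(3) by (simp add: y power_divide)
  then have "real (s ^ p * (q + c)) = real (t ^ p * q)"
    using st(1) assms(5) by (simp add: field_simps)
  then have eq: "s ^ p * (q + c) = t ^ p * q" by (simp only: of_nat_eq_iff)
  have "s ^ p dvd q"
    using eq st(3) by (metis coprime_dvd_mult_right_iff coprime_power_left_iff coprime_power_right_iff dvd_triv_left)
  moreover have "q dvd s ^ p"
  proof -
    have "coprime q (q + c)" using assms(4) by (simp add: coprime_iff_gcd_eq_1)
    moreover have "q dvd s ^ p * (q + c)" unfolding eq by simp
    ultimately show ?thesis by (simp add: coprime_dvd_mult_left_iff)
  qed
  ultimately have q: "q = s ^ p" by (rule dvd_antisym[rotated])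
  then have t: "s ^ p + c = t ^ p" using eq s by simp
  then have "s ^ p < t ^ p" using assms(6) by simp
  then have "s + 1 \<le> t" using power_less_imp_less_base[of s p t] by simp
  show "p = 1"
  proof (rule ccontr)
    assume "p \<noteq> 1"
    then obtain k where k: "p = k + 2" using assms(6,7) by (metis add_2_eq_Suc' le_0_eq not0_implies_Suc not_one_le_zero One_nat_def order.trans)
    have "s ^ p + (p + 1) \<le> (s + 1) ^ p" using perfect_power_gap[OF s, of k] by (simp add: k)
    also have "\<dots> \<le> t ^ p" using \<open>s + 1 \<le> t\<close> by (intro power_mono) auto
    finally show False using t assms(7) by linarith
  qed
qed

text \<open>Writing r - 1 = c/q in lowest terms and \<rho> = q/(q + c), the relation for ln b says
  b^c = \<rho>^q. As c and q are coprime, \<rho> is then the c-th power of a rational number, which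
  forces c = 1, and v is q.\<close>

lemma rational_two_cycle:
  assumes x: "0 < x" "x < 1" and c: "two_cycle x a b" "a < b" and rat: "a \<in> \<rat>" "b \<in> \<rat>"
  obtains v :: nat where "v \<ge> 1" "a = (real v / real (v + 1)) ^ (v + 1)" "b = (real v / real (v + 1)) ^ v"
proof -
  define r where "r = b / a"
  note ran = two_cycle_range[OF x c(1)]
  note logs = two_cycle_logs(1,3)[OF x c, folded r_def]
  have "r - 1 \<in> \<rat>" using rat by (simp add: r_def)
  then obtain c q :: nat where cq: "q \<noteq> 0" "\<bar>r - 1\<bar> = real c / real q" "coprime c q"
    using Rats_abs_nat_div_natE by metis
  then have r1: "r - 1 = real c / real q" using logs(1) by simp
  have c0: "c \<ge> 1" using r1 logs(1) by (cases c) auto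
  define \<rho> where "\<rho> = real q / real (q + c)"
  have \<rho>: "\<rho> > 0" using cq by (simp add: \<rho>_def)
  have r: "r = 1 / \<rho>" using r1 cq by (simp add: \<rho>_def field_simps)
  have lb: "real c * ln b = real q * ln \<rho>"
    using logs(2) cq(1) \<rho> unfolding r1 by (simp add: r ln_div field_simps)
  \<comment> \<open>The c-th root of \<rho>, whose q-th power is b.\<close>
  define y where "y = exp (ln \<rho> / real c)"
  have yc: "y ^ c = \<rho>" using c0 \<rho> by (simp add: y_def flip: exp_of_nat_mult)
  have "ln b = real q * (ln \<rho> / real c)" using lb c0 by (simp add: field_simps)
  then have "y ^ q = exp (ln b)" by (simp only: y_def exp_of_nat_mult)
  then have yq: "y ^ q = b" using ran by simp
  have "y ^ gcd c q \<in> \<rat>"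
    by (rule Rats_power_gcd) (use c0 yc yq rat in \<open>auto simp: y_def \<rho>_def\<close>)
  then have "y \<in> \<rat>" using cq(3) by simp
  then have "c = 1"
    using ratio_perfect_power[of y c q c] yc cq c0 by (simp add: y_def \<rho>_def coprime_commute)
  show ?thesis
  proof (rule that[of q])
    show "q \<ge> 1" using cq by simp
    have \<rho>': "\<rho> = real q / real (q + 1)" using \<open>c = 1\<close> by (simp add: \<rho>_def)
    show b: "b = (real q / real (q + 1)) ^ q" using yq yc \<open>c = 1\<close> \<rho>' by simp
    have "a = b * \<rho>" using r ran \<rho> by (simp add: r_def field_simps)
    then show "a = (real q / real (q + 1)) ^ (q + 1)" unfolding b \<rho>' by simp
  qed
qed

section \<open>The explicit bases and their orders\<close>

text \<open>With \<rho> = v/(v + 1) the exponent is (v + 1) / \<rho>^v, which solves x^(\<rho>^v) =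
  \<rho>^(v + 1) for x.\<close>

definition cycle_base :: "nat \<Rightarrow> real" where
  "cycle_base v = (real v / real (v + 1)) powr (real ((v + 1) ^ (v + 1)) / real (v ^ v))"

lemma cycle_base_unique:
  assumes x: "0 < x" "x < 1" and v: "v \<ge> 1"
    and c: "two_cycle x ((real v / real (v + 1)) ^ (v + 1)) ((real v / real (v + 1)) ^ v)"
  shows "x = cycle_base v"
proof -
  define \<rho> where "\<rho> = real v / real (v + 1)"
  have \<rho>: "\<rho> > 0" using v by (simp add: \<rho>_def)
  have "\<rho> ^ (v + 1) = x powr (\<rho> ^ v)" using c by (simp add: two_cycle_def \<rho>_def)
  then have "ln (\<rho> ^ (v + 1)) = ln (x powr (\<rho> ^ v))" by simp
  then have "real (v + 1) * ln \<rho> = \<rho> ^ v * ln x" using \<rho> x by (simp add: ln_realpow ln_powr del: power_Suc)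
  then have "ln x = real (v + 1) / \<rho> ^ v * ln \<rho>" using \<rho> by (simp add: field_simps)
  also have "real (v + 1) / \<rho> ^ v = real ((v + 1) ^ (v + 1)) / real (v ^ v)"
    using v by (simp add: \<rho>_def power_divide distrib_right)
  finally have "exp (ln x) = exp (real ((v + 1) ^ (v + 1)) / real (v ^ v) * ln \<rho>)" by simp
  then show ?thesis using x v by (simp add: cycle_base_def powr_def \<rho>_def)
qed

lemma cycle_base:
  assumes v: "v \<ge> 1"
  shows "0 < cycle_base v" "cycle_base v < 1"
    and "two_cycle (cycle_base v) ((real v / real (v + 1)) ^ (v + 1)) ((real v / real (v + 1)) ^ v)"
proof -
  define \<rho> where "\<rho> = real v / real (v + 1)"
  define E where "E = real ((v + 1) ^ (v + 1)) / real (v ^ v)"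
  have \<rho>: "\<rho> > 0" "\<rho> < 1" using v by (auto simp: \<rho>_def)
  have E: "E > 0"
    unfolding E_def using v by (intro divide_pos_pos; simp only: of_nat_0_less_iff) auto
  have cb: "cycle_base v = \<rho> powr E" by (simp add: cycle_base_def \<rho>_def E_def)
  show "0 < cycle_base v" "cycle_base v < 1" unfolding cb by (rule powr_between[OF \<rho> E])+
  \<comment> \<open>This product and the next one are the exponents of \<rho> in the two cycle
    equations.\<close>
  have "\<rho> ^ v * E = real (v + 1)"
  proof -
    have "\<rho> ^ v = real v ^ v / real (v + 1) ^ v" by (simp add: \<rho>_def power_divide)
    moreover have "E = real (v + 1) * real (v + 1) ^ v / real v ^ v"
      unfolding E_def of_nat_power by simp
    ultimately show ?thesis using v by (simp del: of_nat_add)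
  qed
  moreover from this have "\<rho> ^ (v + 1) * E = real v" by (simp add: \<rho>_def mult.assoc)
  ultimately have "cycle_base v powr (\<rho> ^ v) = \<rho> ^ (v + 1)" "cycle_base v powr (\<rho> ^ (v + 1)) = \<rho> ^ v"
    unfolding cb powr_powr by (simp_all only: mult.commute[of E] powr_realpow[OF \<rho>(1)])
  then show "two_cycle (cycle_base v) ((real v / real (v + 1)) ^ (v + 1)) ((real v / real (v + 1)) ^ v)"
    by (simp add: two_cycle_def \<rho>_def)
qed

text \<open>The base is Y^M with Y^(v^v) = \<rho>. If Y^(M n) is rational, so is Y^g for g = gcd
  (v^v, M n), and \<rho> is a power of Y^g with exponent v^v / g. That exponent is 1 because \<rho>
  is no proper power; as M is coprime to v^v, v^v divides n.\<close>

lemma cycle_base_power_Rats: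
  assumes v: "v \<ge> 1"
  shows "cycle_base v ^ n \<in> \<rat> \<longleftrightarrow> v ^ v dvd n"
proof -
  define \<rho> where "\<rho> = real v / real (v + 1)"
  define Y where "Y = \<rho> powr (1 / real (v ^ v))"
  define M where "M = (v + 1) ^ (v + 1)"
  have \<rho>: "\<rho> > 0" "\<rho> \<in> \<rat>" using v by (auto simp: \<rho>_def)
  have Y: "Y > 0" using \<rho> by (simp add: Y_def)
  have vv: "v ^ v > 0" using v by simp
  have YM: "cycle_base v = Y ^ M" and Yv: "Y ^ (v ^ v) = \<rho>"
    using \<rho> vv Y by (simp_all add: cycle_base_def Y_def M_def \<rho>_def powr_powr flip: powr_realpow)
  show ?thesis
  proof
    assume "v ^ v dvd n"
    then obtain k where "n = v ^ v * k" ..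
    then have "cycle_base v ^ n = (Y ^ (v ^ v)) ^ (M * k)" by (simp add: YM mult_ac flip: power_mult)
    then show "cycle_base v ^ n \<in> \<rat>" using \<rho>(2) by (simp add: Yv)
  next
    assume "cycle_base v ^ n \<in> \<rat>"
    then have "Y ^ (M * n) \<in> \<rat>" by (simp add: YM power_mult)
    moreover have "Y ^ (v ^ v) \<in> \<rat>" using \<rho>(2) by (simp add: Yv)
    ultimately have g: "Y ^ gcd (v ^ v) (M * n) \<in> \<rat>" using Rats_power_gcd[OF Y vv] by blast
    obtain k where k: "v ^ v = gcd (v ^ v) (M * n) * k" by (meson gcd_dvd1 dvdE)
    have "k = 1"
    proof (rule ratio_perfect_power[OF g])
      show "(Y ^ gcd (v ^ v) (M * n)) ^ k = real v / real (v + 1)"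
        using Yv k by (simp add: \<rho>_def flip: power_mult)
      show "1 \<le> k" using k vv by (cases k) auto
    qed (use Y v in auto)
    then have "v ^ v dvd M * n" using k by (metis gcd_dvd2 mult.right_neutral)
    moreover have "coprime (v ^ v) M"
      unfolding M_def by (intro coprime_power_left_iff[THEN iffD2] coprime_power_right_iff[THEN iffD2] disjI1) simp
    ultimately show "v ^ v dvd n" by (simp add: coprime_dvd_mult_right_iff)
  qed
qed

lemma alg_ord_cycle_base:
  assumes "v \<ge> 1"
  shows "alg_ord (cycle_base v) = enat (v ^ v)"
proof -
  have vv: "v ^ v \<ge> 1" using assms by simp
  have "(LEAST n::nat. n \<ge> 1 \<and> cycle_base v ^ n \<in> \<rat>) = v ^ v"
    using vv by (intro Least_equality) (auto simp: cycle_base_power_Rats[OF assms] dest: dvd_imp_le)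
  moreover have "\<exists>n::nat. n \<ge> 1 \<and> cycle_base v ^ n \<in> \<rat>"
    using vv by (intro exI[of _ "v ^ v"]) (simp add: cycle_base_power_Rats[OF assms])
  ultimately show ?thesis by (simp add: alg_ord_def)
qed

section \<open>Determination of \<open>R_set\<close> and the count\<close>

lemma cycle_base_in_R_set:
  assumes v: "v \<ge> 1"
  shows "cycle_base v \<in> R_set (v ^ v)"
proof -
  let ?\<rho> = "real v / real (v + 1)"
  note cb = cycle_base[OF v]
  have "?\<rho> ^ (v + 1) < ?\<rho> ^ v" using v by (intro power_strict_decreasing) auto
  note lt = two_cycle_imp_less[OF cb this] and h = h_eqI[OF cb this]
  \<comment> \<open>Being a root of its rational power, the base is algebraic.\<close>
  have "cycle_base v = root (v ^ v) (cycle_base v ^ (v ^ v))"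
    using v cb(1) by (simp add: real_root_power_cancel)
  moreover have "cycle_base v ^ (v ^ v) \<in> \<rat>" by (simp add: cycle_base_power_Rats[OF v])
  ultimately have "algebraic (cycle_base v)"
    using algebraic_nth_root_real[of "cycle_base v ^ (v ^ v)" "v ^ v"] rat_imp_algebraic by metis
  moreover have "algebraic (?\<rho> ^ n)" for n by (intro rat_imp_algebraic) simp
  ultimately show ?thesis
    using cb(1) lt alg_ord_cycle_base[OF v] unfolding R_set_def mem_Collect_eq h by blast
qed

lemma R_set_imp_cycle_base:
  assumes "A \<in> R_set k"
  obtains v where "v \<ge> 1" "A = cycle_base v" "k = v ^ v"
proof -
  have A: "algebraic A" "0 < A" "A < exp (- exp 1)" "algebraic (h_o A)" "algebraic (h_e A)" "alg_ord A = enat k"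
    using assms by (auto simp: R_set_def)
  have A1: "A < 1" using A(3) by (rule less_le_trans) simp
  note c = two_cycle_h[OF A(2) A1]
  \<comment> \<open>Each limit is an algebraic exponent that takes the base A to the other limit,
    also algebraic.\<close>
  have "h_e A \<in> \<rat>"
    by (rule real_gelfond_schneider[of A]) (use A A1 c in \<open>auto simp: two_cycle_def\<close>)
  moreover have "h_o A \<in> \<rat>"
    by (rule real_gelfond_schneider[of A]) (use A A1 c in \<open>auto simp: two_cycle_def\<close>)
  ultimately obtain v where v: "v \<ge> 1" "h_o A = (real v / real (v + 1)) ^ (v + 1)" "h_e A = (real v / real (v + 1)) ^ v"
    using rational_two_cycle[OF A(2) A1 c h_o_less_h_e[OF A(2,3)]] by blast
  have "A = cycle_base v" by (rule cycle_base_unique[OF A(2) A1 v(1) c[unfolded v(2,3)]])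
  moreover from this have "k = v ^ v" using A(6) alg_ord_cycle_base[OF v(1)] by simp
  ultimately show ?thesis using v(1) that by blast
qed

lemma self_power_strict_mono:
  fixes u v :: nat
  assumes "1 \<le> u" "u < v"
  shows "u ^ u < v ^ v"
proof -
  have "u ^ u \<le> v ^ u" using assms by (intro power_mono) auto
  also have "\<dots> < v ^ v" using assms by (intro power_strict_increasing) auto
  finally show ?thesis .
qed

theorem theorem6p2:
  fixes k :: nat
  assumes "k \<ge> 1"
  shows "((\<exists>v::nat. k = v ^ v) \<longrightarrow> card (R_set k) = 1) \<and>
         ((\<nexists>v::nat. k = v ^ v) \<longrightarrow> R_set k = {})"
proof (intro conjI impI)
  assume "\<exists>v::nat. k = v ^ v"
  then obtain u :: nat where u: "k = u ^ u" by blast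
  \<comment> \<open>Since 0 ^ 0 = 1 ^ 1, the case u = 0 is represented by v = 1; from 1 on v is
    determined by k.\<close>
  define v where "v = max u 1"
  have v: "v \<ge> 1" "k = v ^ v" using u by (cases "u = 0"; auto simp: v_def max_def)+
  have "R_set k = {cycle_base v}"
  proof (intro equalityI subsetI)
    fix A assume "A \<in> R_set k"
    then obtain w where w: "w \<ge> 1" "A = cycle_base w" "k = w ^ w" by (rule R_set_imp_cycle_base)
    then have "w = v"
      using v self_power_strict_mono[of w v] self_power_strict_mono[of v w] by (metis less_irrefl linorder_neqE_nat)
    then show "A \<in> {cycle_base v}" using w by simp
  qed (use cycle_base_in_R_set[OF v(1)] v(2) in auto)
  then show "card (R_set k) = 1" by simp
next
  assume "\<nexists>v::nat. k = v ^ v"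
  then show "R_set k = {}" using R_set_imp_cycle_base by blast
qed

end
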